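(* Let $\gamma$ be the free flow on $\Phi(\mathrm{k})$ of any rank $\dim\mathrm{k}\in\{1,2,\dots,\infty\}$, with canonical unit $(S_t)_{t\ge0}$. Then $H^\gamma_t=\mathbb{C}S_t$ for all $t\ge0$.
   Context: Free flow: let $\mathrm{k}$ be a separable real Hilbert space with complexification $\mathrm{k}^{\mathbb{C}}$ and $\Gamma_f=\bigoplus_{m\ge0}L^2(\mathbb{R}_+;\mathrm{k}^{\mathbb{C}})^{\otimes m}$ the full Fock space with vacuum $\Omega$. For $f\in L^2(\mathbb{R}_+;\mathrm{k})$ let $l(f)\Omega=f$, $l(f)\xi=f\otimes\xi$ for $\xi\perp\Omega$, and $s(f)=(l(f)+l(f)^* )/2$. Then $\Phi(\mathrm{k})=\{s(f):f\in L^2(\mathbb{R}_+;\mathrm{k})\}''$ is a $\mathrm{II}_1$ factor isomorphic to $L(F_\infty)$, acting standardly on $\Gamma_f=L^2(\Phi(\mathrm{k}))$ with $\Omega$ the cyclic and separating trace vector. With $(T_t)$ the unilateral shift semigroup, $(T_tf)(s)=0$ for $s<t$ and $f(s-t)$ for $s\ge t$, the free flow $\gamma$ of rank $\dim\mathrm{k}$ is the unique weak-$*$ continuous semigroup of normal unital $*$-endomorphisms of $\Phi(\mathrm{k})$ with $\gamma_t(s(f))=s(T_tf)$ for all $f\in L^2(\mathbb{R}_+;\mathrm{k})$. For such a semigroup $\alpha$ on a $\mathrm{II}_1$ factor $\mathrm{M}$ acting standardly on $L^2(\mathrm{M})$ with trace vector $\Omega$ and modular conjugation $J$: the canonical unit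 is the semigroup of isometries $S_t$ with $S_tx\Omega=\alpha_t(x)\Omega$ for $x\in\mathrm{M}$; the complementary semigroup is $\alpha'_t(x')=J\alpha_t(Jx'J)J$ on $\mathrm{M}'$; and $$H^\alpha_t=\{T\in B(L^2(\mathrm{M})):\ \alpha_t(m)T=Tm,\ \alpha'_t(m')T=Tm'\ \ \forall m\in\mathrm{M},\,m'\in\mathrm{M}'\}.$$ *)

theory Defs
  imports "HOL-Analysis.Analysis"
begin

section \<open>Complex Hilbert spaces and bounded operators\<close>

text \<open>The real inner product of the underlying real Hilbert space is the real part of the
  complex one, which is conjugate-linear in its first argument.\<close>

class complex_hilbert = real_inner + banach +
  fixes scaleC :: "complex \<Rightarrow> 'a \<Rightarrow> 'a" (infixr "*\<^sub>C" 75)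
    and cinner :: "'a \<Rightarrow> 'a \<Rightarrow> complex"
  assumes scaleC_add_right: "c *\<^sub>C (x + y) = c *\<^sub>C x + c *\<^sub>C y"
    and scaleC_add_left: "(c + d) *\<^sub>C x = c *\<^sub>C x + d *\<^sub>C x"
    and scaleC_scaleC: "c *\<^sub>C (d *\<^sub>C x) = (c * d) *\<^sub>C x"
    and scaleC_of_real: "complex_of_real r *\<^sub>C x = r *\<^sub>R x"
    and cinner_commute: "cinner x y = cnj (cinner y x)"
    and cinner_add_right: "cinner x (y + z) = cinner x y + cinner x z"
    and cinner_scaleC_right: "cinner x (c *\<^sub>C y) = c * cinner x y"
    and Re_cinner: "Re (cinner x y) = inner x y"

definition bounded_clinear :: "('h::complex_hilbert \<Rightarrow> 'h) \<Rightarrow> bool" where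
  "bounded_clinear A \<longleftrightarrow> bounded_linear A \<and> (\<forall>c x. A (c *\<^sub>C x) = c *\<^sub>C A x)"

definition cadjoint :: "('h::complex_hilbert \<Rightarrow> 'h) \<Rightarrow> 'h \<Rightarrow> 'h" where
  "cadjoint A = (THE B. \<forall>x y. cinner (B x) y = cinner x (A y))"

definition commutant :: "('h::complex_hilbert \<Rightarrow> 'h) set \<Rightarrow> ('h \<Rightarrow> 'h) set" where
  "commutant X = {T. bounded_clinear T \<and> (\<forall>A\<in>X. T \<circ> A = A \<circ> T)}"

text \<open>The \<open>\<sigma>\<close>-weakly continuous functionals on a von Neumann algebra \<open>M\<close>, i.e. the elements of
  its predual; only the values on \<open>M\<close> matter.\<close>

definition normal_functional ::
    "('h::complex_hilbert \<Rightarrow> 'h) set \<Rightarrow> (('h \<Rightarrow> 'h) \<Rightarrow> complex) \<Rightarrow> bool" where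
  "normal_functional M \<rho> \<longleftrightarrow>
     (\<exists>\<xi> \<eta>. summable (\<lambda>n::nat. (norm (\<xi> n))\<^sup>2) \<and> summable (\<lambda>n. (norm (\<eta> n))\<^sup>2) \<and>
        (\<forall>x\<in>M. \<rho> x = (\<Sum>n. cinner (\<xi> n) (x (\<eta> n)))))"

definition normal_unital_star_endomorphism ::
    "('h::complex_hilbert \<Rightarrow> 'h) set \<Rightarrow> (('h \<Rightarrow> 'h) \<Rightarrow> ('h \<Rightarrow> 'h)) \<Rightarrow> bool" where
  "normal_unital_star_endomorphism M \<theta> \<longleftrightarrow>
     (\<forall>x\<in>M. \<theta> x \<in> M) \<and>
     (\<forall>x\<in>M. \<forall>y\<in>M. \<theta> (\<lambda>v. x v + y v) = (\<lambda>v. \<theta> x v + \<theta> y v)) \<and>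
     (\<forall>c. \<forall>x\<in>M. \<theta> (\<lambda>v. c *\<^sub>C x v) = (\<lambda>v. c *\<^sub>C \<theta> x v)) \<and>
     (\<forall>x\<in>M. \<forall>y\<in>M. \<theta> (x \<circ> y) = \<theta> x \<circ> \<theta> y) \<and>
     (\<forall>x\<in>M. \<theta> (cadjoint x) = cadjoint (\<theta> x)) \<and>
     \<theta> id = id \<and>
     (\<forall>\<rho>. normal_functional M \<rho> \<longrightarrow> normal_functional M (\<lambda>x. \<rho> (\<theta> x)))"

definition endomorphism_semigroup ::
    "('h::complex_hilbert \<Rightarrow> 'h) set \<Rightarrow> (real \<Rightarrow> ('h \<Rightarrow> 'h) \<Rightarrow> ('h \<Rightarrow> 'h)) \<Rightarrow> bool" where
  "endomorphism_semigroup M \<alpha> \<longleftrightarrow>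
     (\<forall>t\<ge>0. normal_unital_star_endomorphism M (\<alpha> t)) \<and>
     (\<forall>x\<in>M. \<alpha> 0 x = x) \<and>
     (\<forall>s\<ge>0. \<forall>t\<ge>0. \<forall>x\<in>M. \<alpha> (s + t) x = \<alpha> s (\<alpha> t x)) \<and>
     (\<forall>x\<in>M. \<forall>\<rho>. normal_functional M \<rho> \<longrightarrow> continuous_on {0..} (\<lambda>t. \<rho> (\<alpha> t x)))"


section \<open>The intertwiner spaces of a semigroup in standard form\<close>

text \<open>In this section \<open>M\<close> is a von Neumann algebra with cyclic and separating trace vector
  \<open>\<Omega>\<close>. By traciality the modular operator is trivial, so the modular conjugation is the
  conjugate-linear isometry extending \<open>x \<Omega> \<mapsto> x* \<Omega>\<close>.\<close>

definition modular_conjugation ::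
    "('h::complex_hilbert \<Rightarrow> 'h) set \<Rightarrow> 'h \<Rightarrow> ('h \<Rightarrow> 'h) \<Rightarrow> bool" where
  "modular_conjugation M \<Omega> J \<longleftrightarrow>
     (\<forall>u v. J (u + v) = J u + J v) \<and> (\<forall>c v. J (c *\<^sub>C v) = cnj c *\<^sub>C J v) \<and>
     (\<forall>v. norm (J v) = norm v) \<and> J \<circ> J = id \<and>
     (\<forall>x\<in>M. J (x \<Omega>) = cadjoint x \<Omega>)"

definition canonical_unit ::
    "('h::complex_hilbert \<Rightarrow> 'h) set \<Rightarrow> 'h \<Rightarrow> (real \<Rightarrow> ('h \<Rightarrow> 'h) \<Rightarrow> ('h \<Rightarrow> 'h)) \<Rightarrow>
     (real \<Rightarrow> 'h \<Rightarrow> 'h) \<Rightarrow> bool" where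
  "canonical_unit M \<Omega> \<alpha> S \<longleftrightarrow>
     (\<forall>t\<ge>0. bounded_clinear (S t) \<and> (\<forall>v. norm (S t v) = norm v)) \<and>
     S 0 = id \<and> (\<forall>s\<ge>0. \<forall>t\<ge>0. S (s + t) = S s \<circ> S t) \<and>
     (\<forall>t\<ge>0. \<forall>x\<in>M. S t (x \<Omega>) = \<alpha> t x \<Omega>)"

definition complementary ::
    "('h \<Rightarrow> 'h) \<Rightarrow> (real \<Rightarrow> ('h \<Rightarrow> 'h) \<Rightarrow> ('h \<Rightarrow> 'h)) \<Rightarrow> real \<Rightarrow> ('h \<Rightarrow> 'h) \<Rightarrow> ('h \<Rightarrow> 'h)" where
  "complementary J \<alpha> t x' = J \<circ> \<alpha> t (J \<circ> x' \<circ> J) \<circ> J"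

definition intertwiners ::
    "('h::complex_hilbert \<Rightarrow> 'h) set \<Rightarrow> ('h \<Rightarrow> 'h) \<Rightarrow>
     (real \<Rightarrow> ('h \<Rightarrow> 'h) \<Rightarrow> ('h \<Rightarrow> 'h)) \<Rightarrow> real \<Rightarrow> ('h \<Rightarrow> 'h) set" where
  "intertwiners M J \<alpha> t =
     {T. bounded_clinear T \<and>
         (\<forall>m\<in>M. \<alpha> t m \<circ> T = T \<circ> m) \<and>
         (\<forall>m'\<in>commutant M. complementary J \<alpha> t m' \<circ> T = T \<circ> m')}"


section \<open>Square-integrable functions on the half-line\<close>

definition half_line :: "real measure" where
  "half_line = restrict_space lborel {0..}"

text \<open>Representatives of the elements of \<open>L\<^sup>2(\<real>\<^sub>+; V)\<close>; functions that agree almost everywhere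
  on the half-line are not identified. Everything below depends only on the class of a function.\<close>

definition L2_fun :: "(real \<Rightarrow> 'v::{real_inner, second_countable_topology}) set" where
  "L2_fun = {f. f \<in> borel_measurable half_line \<and> integrable half_line (\<lambda>s. (norm (f s))\<^sup>2)}"

text \<open>A pair \<open>(a, b)\<close> stands for the element \<open>a + \<i> b\<close> of the complexification; the library norm
  on pairs is the norm of this inner product.\<close>

definition complexification_inner :: "'k::real_inner \<times> 'k \<Rightarrow> 'k \<times> 'k \<Rightarrow> complex" where
  "complexification_inner u v =
     Complex (inner (fst u) (fst v) + inner (snd u) (snd v))
             (inner (fst u) (snd v) - inner (snd u) (fst v))"

definition L2_inner :: "(real \<Rightarrow> 'k::real_inner \<times> 'k) \<Rightarrow> (real \<Rightarrow> 'k \<times> 'k) \<Rightarrow> complex" where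
  "L2_inner f g = integral\<^sup>L half_line (\<lambda>s. complexification_inner (f s) (g s))"

definition complexify :: "(real \<Rightarrow> 'k::real_inner) \<Rightarrow> real \<Rightarrow> 'k \<times> 'k" where
  "complexify f = (\<lambda>s. (f s, 0))"

definition shift :: "real \<Rightarrow> (real \<Rightarrow> 'v::zero) \<Rightarrow> real \<Rightarrow> 'v" where
  "shift t f = (\<lambda>s. if s < t then 0 else f (s - t))"


section \<open>The full Fock space and the free flow\<close>

text \<open>A realisation of the full Fock space \<open>\<Oplus>\<^sub>m L\<^sup>2(\<real>\<^sub>+; k\<^sup>\<complex>)\<^sup>\<otimes>\<^sup>m\<close>: a Hilbert space together with its
  elementary tensors \<open>ten [f\<^sub>1, \<dots>, f\<^sub>m] = f\<^sub>1 \<otimes> \<dots> \<otimes> f\<^sub>m\<close>. The first clause is the inner product of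
  the Hilbert space tensor powers, with different powers being orthogonal; the second says that
  the space is the completion of the algebraic Fock space. Hence \<open>ten\<close> is multilinear and
  insensitive to null sets, and any two realisations are identified by a unique unitary matching
  their elementary tensors.\<close>

definition full_fock_space ::
    "((real \<Rightarrow> 'k::{real_inner, banach, second_countable_topology} \<times> 'k) list \<Rightarrow>
      'h::complex_hilbert) \<Rightarrow> bool" where
  "full_fock_space ten \<longleftrightarrow>
     (\<forall>fs\<in>lists L2_fun. \<forall>gs\<in>lists L2_fun.
        cinner (ten fs) (ten gs) =
          (if length fs = length gs then prod_list (map2 L2_inner fs gs) else 0)) \<and>
     closure (module.span scaleC (ten ` lists L2_fun)) = UNIV"

abbreviation vacuum :: "('f list \<Rightarrow> 'h) \<Rightarrow> 'h" where
  "vacuum ten \<equiv> ten []"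

text \<open>The bounded operator with \<open>\<Omega> \<mapsto> f\<close> and \<open>\<xi> \<mapsto> f \<otimes> \<xi>\<close> for \<open>\<xi> \<bottom> \<Omega>\<close>, specified on the total set of
  elementary tensors.\<close>

definition creation ::
    "((real \<Rightarrow> 'k::{real_inner, banach, second_countable_topology} \<times> 'k) list \<Rightarrow>
      'h::complex_hilbert) \<Rightarrow> (real \<Rightarrow> 'k \<times> 'k) \<Rightarrow> 'h \<Rightarrow> 'h" where
  "creation ten f =
     (THE A. bounded_clinear A \<and> (\<forall>fs\<in>lists L2_fun. A (ten fs) = ten (f # fs)))"

definition semicircular ::
    "((real \<Rightarrow> 'k::{real_inner, banach, second_countable_topology} \<times> 'k) list \<Rightarrow>
      'h::complex_hilbert) \<Rightarrow> (real \<Rightarrow> 'k) \<Rightarrow> 'h \<Rightarrow> 'h" where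
  "semicircular ten f =
     (\<lambda>v. (creation ten (complexify f) v + cadjoint (creation ten (complexify f)) v) /\<^sub>R 2)"

definition free_vN_algebra ::
    "((real \<Rightarrow> 'k::{real_inner, banach, second_countable_topology} \<times> 'k) list \<Rightarrow>
      'h::complex_hilbert) \<Rightarrow> ('h \<Rightarrow> 'h) set" where
  "free_vN_algebra ten = commutant (commutant (semicircular ten ` L2_fun))"

definition free_flow ::
    "((real \<Rightarrow> 'k::{real_inner, banach, second_countable_topology} \<times> 'k) list \<Rightarrow>
      'h::complex_hilbert) \<Rightarrow> (real \<Rightarrow> ('h \<Rightarrow> 'h) \<Rightarrow> ('h \<Rightarrow> 'h)) \<Rightarrow> bool" where
  "free_flow ten \<gamma> \<longleftrightarrow>
     endomorphism_semigroup (free_vN_algebra ten) \<gamma> \<and>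
     (\<forall>t\<ge>0. \<forall>f\<in>L2_fun. \<gamma> t (semicircular ten f) = semicircular ten (shift t f))"

end

theory Submission imports Defs begin

text \<open>An intertwiner \<open>T\<close> is determined by \<open>\<xi> = T \<Omega>\<close>, since \<open>T m \<Omega> = \<gamma>\<^sub>t(m) \<xi>\<close>. The intertwining relations
  for \<open>s(f)\<close> and for \<open>J s(f) J\<close>, which is the right semicircular operator \<open>s\<^sub>r(f)\<close>, give
  \<open>s(T\<^sub>t f) \<xi> = T s(f) \<Omega> = T s\<^sub>r(f) \<Omega> = s\<^sub>r(T\<^sub>t f) \<xi>\<close>. Take orthonormal \<open>g\<^sub>n\<close> in the range of \<open>T\<^sub>t\<close>. The
  annihilation parts \<open>l(g\<^sub>n)\<^sup>* \<xi>\<close> and \<open>r(g\<^sub>n)\<^sup>* \<xi>\<close> tend to zero by Bessel's inequality, hence so does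
  \<open>l(g\<^sub>n) \<xi> - r(g\<^sub>n) \<xi>\<close>; but \<open>l(g\<^sub>n) \<zeta>\<close> and \<open>r(g\<^sub>n) \<zeta>\<close> are asymptotically orthogonal for the part \<open>\<zeta>\<close>
  of \<open>\<xi>\<close> orthogonal to \<open>\<Omega>\<close>, and they agree on \<open>\<Omega>\<close>. So \<open>\<zeta> = 0\<close> and \<open>\<xi> \<in> \<complex> \<Omega>\<close>. Conversely \<open>S\<^sub>t\<close> commutes
  with \<open>J\<close>, and \<open>J M' J = M\<close> because \<open>\<Omega>\<close> is a trace vector.\<close>

section \<open>Complex Hilbert spaces\<close>

text \<open>The class inherits only a real vector space structure; this gives spans and subspaces
  over the complex scalars.\<close>

interpretation complex_vector: vector_space "scaleC :: complex \<Rightarrow> 'a::complex_hilbert \<Rightarrow> 'a"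
proof
  show "1 *\<^sub>C x = x" for x :: 'a
    using scaleC_of_real[of 1 x] by simp
qed (rule scaleC_add_right scaleC_add_left scaleC_scaleC)+

lemma cinner_add_left: "cinner (x + y) z = cinner x z + cinner y z"
  by (metis cinner_commute cinner_add_right complex_cnj_add)

lemma cinner_scaleC_left: "cinner (c *\<^sub>C x) z = cnj c * cinner x z"
  by (metis cinner_commute cinner_scaleC_right complex_cnj_mult)

lemma cinner_zero [simp]: "cinner 0 x = 0" "cinner x 0 = 0"
  using cinner_add_left[of 0 0 x] cinner_add_right[of x 0 0] by simp_all

lemma cinner_minus: "cinner (- x) y = - cinner x y" "cinner x (- y) = - cinner x y"
  using cinner_add_left[of x "- x" y] cinner_add_right[of x y "- y"]
  by (simp_all add: eq_neg_iff_add_eq_0 add.commute)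

lemma cinner_diff_left: "cinner (x - y) z = cinner x z - cinner y z"
  using cinner_add_left[of x "- y" z] by (simp add: cinner_minus)

lemma cinner_diff_right: "cinner x (y - z) = cinner x y - cinner x z"
  using cinner_add_right[of x y "- z"] by (simp add: cinner_minus)

lemma cinner_sum_left: "cinner (sum f A) z = (\<Sum>i\<in>A. cinner (f i) z)"
  by (induction A rule: infinite_finite_induct) (simp_all add: cinner_add_left)

lemmas cinner_simps = cinner_add_left cinner_add_right cinner_scaleC_left cinner_scaleC_right
  cinner_diff_left cinner_diff_right

lemma cinner_self: "cinner x x = complex_of_real ((norm x)\<^sup>2)"
proof (rule complex_eqI)
  show "Re (cinner x x) = Re (complex_of_real ((norm x)\<^sup>2))"
    by (simp add: Re_cinner power2_norm_eq_inner)
  have "Im (cinner x x) = Im (cnj (cinner x x))"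
    using cinner_commute[of x x] by simp
  then show "Im (cinner x x) = Im (complex_of_real ((norm x)\<^sup>2))" by simp
qed

lemma cinner_self_eq_0 [simp]: "cinner x x = 0 \<longleftrightarrow> x = 0"
  by (simp add: cinner_self)

text \<open>Recovers the complex inner product from the real one, so that real arguments such as
  Riesz representation and polarisation carry over.\<close>

lemma cinner_eq_Complex: "cinner x y = Complex (inner x y) (- inner x (\<i> *\<^sub>C y))"
  by (rule complex_eqI) (simp_all add: Re_cinner[symmetric] cinner_scaleC_right)

lemma norm_scaleC: "norm (c *\<^sub>C x) = cmod c * norm x"
proof -
  have "cinner (c *\<^sub>C x) (c *\<^sub>C x) = (c * cnj c) * cinner x x"
    by (simp add: cinner_simps)
  then have "complex_of_real ((norm (c *\<^sub>C x))\<^sup>2) = complex_of_real ((cmod c * norm x)\<^sup>2)"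
    unfolding cinner_self complex_norm_square[symmetric] by (simp add: power_mult_distrib)
  then show ?thesis
    unfolding of_real_eq_iff by (rule power2_eq_imp_eq) simp_all
qed

lemma norm_cinner_le: "cmod (cinner x y) \<le> norm x * norm y"
proof (cases "cinner x y = 0")
  case False
  \<comment> \<open>The conjugate phase of \<open>cinner x y\<close> rotates it to its modulus,
    which leaves the real Cauchy-Schwarz inequality.\<close>
  define c where "c = cnj (sgn (cinner x y))"
  have "c * cinner x y = cmod (cinner x y)"
    using False complex_norm_square[of "cinner x y"]
    by (simp add: c_def sgn_div_norm scaleR_conv_of_real field_simps power2_eq_square)
  then have "cmod (cinner x y) = inner x (c *\<^sub>C y)"
    by (simp add: Re_cinner[symmetric] cinner_simps)
  also have "\<dots> \<le> norm x * norm (c *\<^sub>C y)"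
    by (rule norm_cauchy_schwarz)
  finally show ?thesis
    using False by (simp add: norm_scaleC c_def norm_sgn)
qed simp

lemma bounded_linear_scaleC: "bounded_linear (\<lambda>x. c *\<^sub>C x)"
proof (rule bounded_linear_intro)
  show "c *\<^sub>C (r *\<^sub>R x) = r *\<^sub>R (c *\<^sub>C x)" for r x
    by (simp add: scaleC_of_real[symmetric] scaleC_scaleC mult.commute)
  show "norm (c *\<^sub>C x) \<le> norm x * cmod c" for x
    by (simp add: norm_scaleC mult.commute)
qed (simp add: scaleC_add_right)

lemma bounded_bilinear_cinner: "bounded_bilinear cinner"
proof
  show "cinner (r *\<^sub>R a) b = r *\<^sub>R cinner a b" "cinner a (r *\<^sub>R b) = r *\<^sub>R cinner a b" for r a b
    by (simp_all add: scaleC_of_real[symmetric] cinner_simps scaleR_conv_of_real)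
  show "\<exists>K. \<forall>a b. cmod (cinner a b) \<le> norm a * norm b * K"
    by (intro exI[of _ 1]) (simp add: norm_cinner_le)
qed (simp_all add: cinner_simps)

lemmas tendsto_cinner = bounded_bilinear.tendsto[OF bounded_bilinear_cinner]
  and continuous_on_cinner = bounded_bilinear.continuous_on[OF bounded_bilinear_cinner]

lemma cinner_eqI: "(\<And>x. cinner x u = cinner x v) \<Longrightarrow> u = v"
  using cinner_self_eq_0[of "u - v"] by (simp add: cinner_diff_right del: cinner_self_eq_0)

text \<open>The density argument used throughout, with \<open>C\<close> either the set where two
  continuous expressions agree or the domain of a closed relation.\<close>

lemma closed_subspace_total:
  assumes "closure (module.span scaleC X) = (UNIV :: 'h::complex_hilbert set)"
    and "closed C" "0 \<in> C" "\<And>u v. u \<in> C \<Longrightarrow> v \<in> C \<Longrightarrow> u + v \<in> C"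
    and "\<And>c u. u \<in> C \<Longrightarrow> c *\<^sub>C u \<in> C" "X \<subseteq> C"
  shows "C = UNIV"
proof -
  have "complex_vector.span X \<subseteq> C"
    using assms by (intro complex_vector.span_minimal) (auto simp: complex_vector.subspace_def)
  then have "closure (complex_vector.span X) \<subseteq> C"
    using assms(2) by (rule closure_minimal)
  with assms(1) show ?thesis by auto
qed

text \<open>The vectors \<open>x\<close> with equal pairings form a closed complex subspace;
  conjugate linearity in \<open>x\<close> does no harm.\<close>

lemma total_cinner_eqI:
  fixes u v :: "'h::complex_hilbert"
  assumes "closure (module.span scaleC X) = (UNIV :: 'h set)"
    and "\<And>x. x \<in> X \<Longrightarrow> cinner x u = cinner x v"
  shows "u = v"
proof (rule cinner_eqI)
  have "{x. cinner x u = cinner x v} = UNIV"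
    using assms(2)
    by (intro closed_subspace_total[OF assms(1)] closed_Collect_eq continuous_on_cinner
        continuous_intros) (auto simp: cinner_simps)
  then show "cinner x u = cinner x v" for x by auto
qed

section \<open>Bounded operators and adjoints\<close>

lemma bounded_clinearD:
  assumes "bounded_clinear A"
  shows "bounded_linear A" "A (c *\<^sub>C x) = c *\<^sub>C A x" "A (x + y) = A x + A y"
    "A (x - y) = A x - A y" "A 0 = 0" "A (r *\<^sub>R x) = r *\<^sub>R A x" "A (sum f I) = (\<Sum>i\<in>I. A (f i))"
  using assms bounded_linear.linear[of A]
  by (auto simp: bounded_clinear_def linear_simps linear_0 linear_diff linear_add linear_cmul
      linear_sum)

lemma bounded_clinear_id: "bounded_clinear id"
  by (simp add: bounded_clinear_def id_def)

lemma bounded_clinear_comp: "bounded_clinear A \<Longrightarrow> bounded_clinear B \<Longrightarrow> bounded_clinear (A \<circ> B)"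
  by (auto simp: bounded_clinear_def o_def bounded_linear_compose)

lemma bounded_clinear_add:
  "bounded_clinear A \<Longrightarrow> bounded_clinear B \<Longrightarrow> bounded_clinear (\<lambda>v. A v + B v)"
  by (auto simp: bounded_clinear_def bounded_linear_add scaleC_add_right)

lemma bounded_clinear_scaleC: "bounded_clinear A \<Longrightarrow> bounded_clinear (\<lambda>v. c *\<^sub>C A v)"
  using bounded_linear_compose[OF bounded_linear_scaleC]
  by (auto simp: bounded_clinear_def o_def scaleC_scaleC mult.commute)

lemma bounded_clinear_total_eqI:
  assumes "closure (module.span scaleC X) = (UNIV :: 'h::complex_hilbert set)"
    and "bounded_clinear A" "bounded_clinear B" "\<And>x. x \<in> X \<Longrightarrow> A x = B x"
  shows "A = B"
proof -
  have "{x. A x = B x} = UNIV"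
    using assms(4) bounded_clinearD[OF assms(2)] bounded_clinearD[OF assms(3)]
    by (intro closed_subspace_total[OF assms(1)] closed_Collect_eq)
      (auto intro: linear_continuous_on)
  then show ?thesis by auto
qed

lemma bounded_clinear_dense_eqI:
  assumes "closure D = (UNIV :: 'h::complex_hilbert set)"
    and "bounded_clinear A" "bounded_clinear B" "\<And>x. x \<in> D \<Longrightarrow> A x = B x"
  shows "A = B"
proof (rule bounded_clinear_total_eqI[of D])
  show "closure (complex_vector.span D) = UNIV"
    using closure_mono[OF complex_vector.span_superset, of D] assms(1) by auto
qed (use assms in auto)

text \<open>The representing vector minimises \<open>\<parallel>y\<parallel>\<^sup>2 / 2 - \<phi> y\<close>.\<close>

lemma riesz_representation:
  fixes \<phi> :: "'a::{real_inner, banach} \<Rightarrow> real"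
  assumes "bounded_linear \<phi>"
  shows "\<exists>z. \<forall>y. \<phi> y = inner z y"
proof -
  interpret \<phi>: bounded_linear \<phi> by fact
  define q where "q y = inner y y / 2 - \<phi> y" for y
  obtain K where K: "\<And>y. norm (\<phi> y) \<le> norm y * K"
    using \<phi>.bounded by blast
  have low: "- (K\<^sup>2 / 2) \<le> q y" for y
  proof -
    have "0 \<le> (norm y - K)\<^sup>2" by simp
    then have "norm y * K \<le> inner y y / 2 + K\<^sup>2 / 2"
      by (simp add: power2_diff power2_norm_eq_inner mult.commute field_simps)
    with K[of y] show ?thesis by (simp add: q_def)
  qed
  have bdd: "bdd_below (range q)"
    using low by (intro bdd_belowI[of _ "- (K\<^sup>2 / 2)"]) auto
  define m where "m = Inf (range q)"
  have m_le: "m \<le> q y" for y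
    unfolding m_def using bdd by (rule cInf_lower[rotated]) auto
  have "\<exists>y. q y < m + 1 / Suc n" for n
    using cInf_lessD[of "range q" "m + 1 / Suc n"] by (auto simp: m_def)
  then obtain y where y: "\<And>n. q (y n) < m + 1 / Suc n" by metis
  \<comment> \<open>The parallelogram law, combined with \<open>q\<close> being at least
    \<open>m\<close> at the midpoint of \<open>a\<close> and \<open>b\<close>. It makes a minimising
    sequence Cauchy.\<close>
  have par: "(norm (a - b))\<^sup>2 \<le> 4 * (q a - m) + 4 * (q b - m)" for a b
  proof -
    have "q ((1 / 2) *\<^sub>R (a + b)) = q a / 2 + q b / 2 - (norm (a - b))\<^sup>2 / 8"
      unfolding q_def power2_norm_eq_inner \<phi>.scaleR \<phi>.add
      by (simp add: inner_add_left inner_add_right inner_diff_left inner_diff_right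
          inner_commute field_simps)
    with m_le[of "(1 / 2) *\<^sub>R (a + b)"] show ?thesis by simp
  qed
  have "Cauchy y"
  proof (rule metric_CauchyI)
    fix e :: real assume "e > 0"
    \<comment> \<open>Two values within \<open>1 / Suc N\<close> of \<open>m\<close>, each weighted
      by 4 in \<open>par\<close>, account for the 8.\<close>
    then obtain N where N: "8 / e\<^sup>2 < real (Suc N)"
      by (meson less_Suc_eq reals_Archimedean2 of_nat_less_iff order.strict_trans)
    show "\<exists>N. \<forall>i\<ge>N. \<forall>j\<ge>N. dist (y i) (y j) < e"
    proof (intro exI[of _ N] allI impI)
      fix i j assume ij: "i \<ge> N" "j \<ge> N"
      define k where "k = 1 / real (Suc N)"
      have le: "q (y i) - m < k" if "i \<ge> N" for i
      proof -
        have "1 / real (Suc i) \<le> 1 / real (Suc N)" using that by (simp add: frac_le)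
        with y[of i] show ?thesis unfolding k_def by linarith
      qed
      have k: "8 * k < e\<^sup>2"
        using N \<open>e > 0\<close> by (simp add: k_def field_simps)
      have "(norm (y i - y j))\<^sup>2 \<le> 4 * (q (y i) - m) + 4 * (q (y j) - m)"
        by (rule par)
      also have "\<dots> < 4 * k + 4 * k"
        by (intro add_strict_mono mult_strict_left_mono le ij) simp_all
      also have "\<dots> < e\<^sup>2"
        using k by simp
      finally show "dist (y i) (y j) < e"
        using \<open>e > 0\<close> by (simp add: dist_norm power2_less_imp_less)
    qed
  qed
  then obtain z where z: "y \<longlonglongrightarrow> z"
    using Cauchy_convergent convergent_def by blast
  have "(\<lambda>n. q (y n)) \<longlonglongrightarrow> q z"
    unfolding q_def by (intro tendsto_intros z \<phi>.tendsto) simp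
  moreover have "(\<lambda>n. m + 1 / real (Suc n)) \<longlonglongrightarrow> m + 0"
    using LIMSEQ_inverse_real_of_nat by (intro tendsto_intros) (simp add: inverse_eq_divide)
  ultimately have "q z \<le> m"
    using y by (intro LIMSEQ_le[of "\<lambda>n. q (y n)" _ "\<lambda>n. m + 1 / real (Suc n)"]) (auto intro: less_imp_le)
  have "\<phi> w = inner z w" for w
  proof -
    define d where "d = inner z w - \<phi> w"
    \<comment> \<open>Minimality of \<open>z\<close> on the line in direction \<open>w\<close>: the
      right side is \<open>q (z + r *\<^sub>R w) - q z\<close>.\<close>
    have ineq: "0 \<le> r * d + r\<^sup>2 * (inner w w / 2)" for r
    proof -
      have "q z \<le> q (z + r *\<^sub>R w)"
        using \<open>q z \<le> m\<close> m_le by (rule order_trans)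
      then show ?thesis
        unfolding q_def d_def \<phi>.scaleR \<phi>.add
        by (simp add: inner_add_left inner_add_right inner_commute power2_eq_square field_simps)
    qed
    have "d = 0"
    proof (cases "w = 0")
      case False
      then have p: "inner w w > 0" by simp
      \<comment> \<open>The value \<open>r = - d / inner w w\<close> minimises the quadratic
        polynomial in \<open>ineq\<close>.\<close>
      have "0 \<le> - (d\<^sup>2 / (2 * inner w w))"
        using ineq[of "- d / inner w w"] p by (simp add: field_simps power2_eq_square)
      then show ?thesis using p
        by (simp add: divide_le_0_iff zero_le_divide_iff)
    qed (simp add: d_def)
    then show ?thesis by (simp add: d_def)
  qed
  then show ?thesis by blast
qed

text \<open>\<open>cadjoint\<close> is a definite description, so a witness is needed. Riesz
  representation supplies one for the real inner product; it serves the complex one because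
  \<open>A\<close> commutes with multiplication by \<open>\<i>\<close>.\<close>

lemma cadjoint_cinner_left:
  assumes "bounded_clinear A"
  shows "cinner (cadjoint A x) y = cinner x (A y)"
proof -
  have "\<exists>z. \<forall>y. inner x (A y) = inner z y" for x
    using bounded_linear_compose[OF bounded_linear_inner_right bounded_clinearD(1)[OF assms]]
    by (intro riesz_representation) (simp add: o_def)
  then obtain B where B: "\<And>x y. inner x (A y) = inner (B x) y" by metis
  have B': "\<forall>x y. cinner (B x) y = cinner x (A y)"
    by (simp add: cinner_eq_Complex B bounded_clinearD(2)[OF assms, symmetric])
  have "\<forall>x y. cinner (cadjoint A x) y = cinner x (A y)"
    unfolding cadjoint_def
  proof (rule theI[of _ B])
    fix B' assume "\<forall>x y. cinner (B' x) y = cinner x (A y)"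
    with B' show "B' = B"
      by (intro ext cinner_eqI) (metis cinner_commute)
  qed fact
  then show ?thesis by blast
qed

lemma cadjoint_cinner_right:
  "bounded_clinear A \<Longrightarrow> cinner x (cadjoint A y) = cinner (A x) y"
  by (metis cinner_commute cadjoint_cinner_left)

lemma cadjoint_eqI:
  assumes "bounded_clinear A" "\<And>x y. cinner (B x) y = cinner x (A y)"
  shows "cadjoint A = B"
  using assms by (intro ext cinner_eqI) (metis cinner_commute cadjoint_cinner_left)

lemma bounded_clinear_cadjoint:
  assumes "bounded_clinear A"
  shows "bounded_clinear (cadjoint A)"
proof -
  obtain K where K: "\<And>x. norm (A x) \<le> norm x * K" "K \<ge> 0"
    using bounded_linear.nonneg_bounded[OF bounded_clinearD(1)[OF assms]] by blast
  have scale: "cadjoint A (c *\<^sub>C x) = c *\<^sub>C cadjoint A x" for c x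
    by (rule cinner_eqI) (simp add: cadjoint_cinner_right assms cinner_simps)
  have "bounded_linear (cadjoint A)"
  proof (rule bounded_linear_intro)
    show "cadjoint A (x + y) = cadjoint A x + cadjoint A y" for x y
      by (rule cinner_eqI) (simp add: cadjoint_cinner_right assms cinner_simps)
    show "cadjoint A (r *\<^sub>R x) = r *\<^sub>R cadjoint A x" for r x
      using scale[of "complex_of_real r" x] by (simp add: scaleC_of_real)
    show "norm (cadjoint A x) \<le> norm x * K" for x
    proof (cases "cadjoint A x = 0")
      case False
      have "(norm (cadjoint A x))\<^sup>2 = cmod (cinner (cadjoint A x) (cadjoint A x))"
        by (simp add: cinner_self norm_power)
      also have "\<dots> = cmod (cinner x (A (cadjoint A x)))"
        by (simp add: cadjoint_cinner_left assms)
      also have "\<dots> \<le> norm x * norm (A (cadjoint A x))"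
        by (rule norm_cinner_le)
      also have "\<dots> \<le> norm x * (norm (cadjoint A x) * K)"
        by (intro mult_left_mono K) simp
      finally show ?thesis
        using False by (simp add: power2_eq_square mult_ac)
    qed (use K in simp)
  qed
  with scale show ?thesis by (simp add: bounded_clinear_def)
qed

lemma cadjoint_cadjoint: "bounded_clinear A \<Longrightarrow> cadjoint (cadjoint A) = A"
  by (intro cadjoint_eqI bounded_clinear_cadjoint) (simp_all add: cadjoint_cinner_right)

lemma cadjoint_comp:
  "bounded_clinear A \<Longrightarrow> bounded_clinear B \<Longrightarrow> cadjoint (A \<circ> B) = cadjoint B \<circ> cadjoint A"
  by (intro cadjoint_eqI bounded_clinear_comp) (simp_all add: cadjoint_cinner_left)

lemma cadjoint_id: "cadjoint id = id"
  by (rule cadjoint_eqI) (simp_all add: bounded_clinear_id)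

text \<open>Serves the left and the right semicircular operators alike.\<close>

lemma half_sum_adjoint:
  assumes "bounded_clinear A"
  shows "bounded_clinear (\<lambda>v. (A v + cadjoint A v) /\<^sub>R 2)"
    and "cadjoint (\<lambda>v. (A v + cadjoint A v) /\<^sub>R 2) = (\<lambda>v. (A v + cadjoint A v) /\<^sub>R 2)"
proof -
  have *: "(A v + cadjoint A v) /\<^sub>R 2 = complex_of_real (inverse 2) *\<^sub>C (A v + cadjoint A v)" for v
    by (simp only: scaleC_of_real)
  show "bounded_clinear (\<lambda>v. (A v + cadjoint A v) /\<^sub>R 2)"
    unfolding *
    by (intro bounded_clinear_scaleC bounded_clinear_add bounded_clinear_cadjoint assms)
  then show "cadjoint (\<lambda>v. (A v + cadjoint A v) /\<^sub>R 2) = (\<lambda>v. (A v + cadjoint A v) /\<^sub>R 2)"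
    by (rule cadjoint_eqI)
      (simp only: * cinner_simps cadjoint_cinner_left[OF assms] cadjoint_cinner_right[OF assms]
        complex_cnj_complex_of_real add.commute)
qed

text \<open>The closed linear relation generated by \<open>P\<close>; it is the graph of a multiple of an isometry as
  soon as the two families of coordinates have proportional Gram matrices.\<close>

inductive graph_closure :: "('h::complex_hilbert \<times> 'h) set \<Rightarrow> 'h \<Rightarrow> 'h \<Rightarrow> bool" for P where
  base: "(x, y) \<in> P \<Longrightarrow> graph_closure P x y"
| zero: "graph_closure P 0 0"
| add: "graph_closure P x y \<Longrightarrow> graph_closure P x' y' \<Longrightarrow> graph_closure P (x + x') (y + y')"
| scale: "graph_closure P x y \<Longrightarrow> graph_closure P (c *\<^sub>C x) (c *\<^sub>C y)"
| lim: "(\<And>n. graph_closure P (u n) (v n)) \<Longrightarrow> u \<longlonglongrightarrow> x \<Longrightarrow> v \<longlonglongrightarrow> y \<Longrightarrow> graph_closure P x y"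

lemma graph_closure_cinner_base:
  assumes "graph_closure P x y"
    and "\<And>x' y'. (x', y') \<in> P \<Longrightarrow> cinner y' b = \<kappa> * cinner x' a"
  shows "cinner y b = \<kappa> * cinner x a"
  using assms(1)
proof induction
  case (lim u v x y)
  have "(\<lambda>n. cinner (v n) b) \<longlonglongrightarrow> cinner y b" "(\<lambda>n. \<kappa> * cinner (u n) a) \<longlonglongrightarrow> \<kappa> * cinner x a"
    by (intro tendsto_cinner tendsto_intros lim)+
  then show ?case
    using lim by (simp add: LIMSEQ_unique)
qed (simp_all add: assms(2) cinner_simps algebra_simps)

text \<open>The one-variable induction is applied once in each slot, with a conjugation in between;
  this is why \<open>\<kappa>\<close> is real here.\<close>

lemma graph_closure_cinner:
  assumes "graph_closure P x y" "graph_closure P x' y'"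
    and "\<And>x y x' y'. (x, y) \<in> P \<Longrightarrow> (x', y') \<in> P \<Longrightarrow>
      cinner y y' = complex_of_real \<kappa> * cinner x x'"
  shows "cinner y y' = complex_of_real \<kappa> * cinner x x'"
proof (rule graph_closure_cinner_base[OF assms(1)])
  fix p q assume pq: "(p, q) \<in> P"
  have "cinner y' q = complex_of_real \<kappa> * cinner x' p"
    by (rule graph_closure_cinner_base[OF assms(2)]) (use assms(3) pq in blast)
  then have "cnj (cinner y' q) = complex_of_real \<kappa> * cnj (cinner x' p)" by simp
  then show "cinner q y' = complex_of_real \<kappa> * cinner p x'"
    by (simp add: cinner_commute[symmetric])
qed

text \<open>Builds an operator from its values on a total family that may be linearly dependent. The
  Gram condition makes the closed relation single-valued, since a pair \<open>(0, y)\<close> has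
  \<open>norm y = 0\<close>, and bounded, so that its domain is closed and hence everything.\<close>

lemma gram_extension:
  fixes e e' :: "'i \<Rightarrow> 'h::complex_hilbert"
  assumes gram: "\<And>i j. i \<in> I \<Longrightarrow> j \<in> I \<Longrightarrow>
      cinner (e' i) (e' j) = complex_of_real \<kappa> * cinner (e i) (e j)"
    and total: "closure (module.span scaleC (e ` I)) = UNIV"
  shows "\<exists>!A. bounded_clinear A \<and> (\<forall>i\<in>I. A (e i) = e' i)"
proof (rule ex_ex1I)
  define P where "P = (\<lambda>i. (e i, e' i)) ` I"
  define G where "G = graph_closure P"
  have G_cinner: "cinner y y' = complex_of_real \<kappa> * cinner x x'" if "G x y" "G x' y'" for x y x' y'
    using that unfolding G_def by (rule graph_closure_cinner) (auto simp: P_def gram)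
  have G_norm: "(norm y)\<^sup>2 = \<kappa> * (norm x)\<^sup>2" if "G x y" for x y
    using G_cinner[OF that that] unfolding cinner_self of_real_mult[symmetric] of_real_eq_iff .
  \<comment> \<open>The sign of \<open>\<kappa>\<close> is not prescribed, hence the absolute
    value.\<close>
  have G_bound: "norm y \<le> norm x * sqrt \<bar>\<kappa>\<bar>" if "G x y" for x y
  proof -
    have "norm y = sqrt (\<kappa> * (norm x)\<^sup>2)"
      by (simp add: G_norm[OF that, symmetric])
    also have "\<dots> \<le> sqrt (\<bar>\<kappa>\<bar> * (norm x)\<^sup>2)"
      by (intro real_sqrt_le_mono mult_right_mono) auto
    finally show ?thesis by (simp add: real_sqrt_mult mult.commute)
  qed
  have G_add: "G (x + x') (y + y')" if "G x y" "G x' y'" for x y x' y'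
    using that unfolding G_def by (rule graph_closure.add)
  have G_scale: "G (c *\<^sub>C x) (c *\<^sub>C y)" if "G x y" for c x y
    using that unfolding G_def by (rule graph_closure.scale)
  have G_diff: "G (x - x') (y - y')" if "G x y" "G x' y'" for x y x' y'
    using G_add[OF that(1) G_scale[OF that(2), of "- 1"]]
    by (simp add: complex_vector.scale_minus_left)
  have G_unique: "y = y'" if "G x y" "G x y'" for x y y'
    using G_norm[OF G_diff[OF that]] by simp
  have "{x. \<exists>y. G x y} = UNIV"
  proof (rule closed_subspace_total[OF total])
    show "closed {x. \<exists>y. G x y}"
      unfolding closed_sequential_limits
    proof clarify
      fix u x assume u: "\<forall>n. u n \<in> {x. \<exists>y. G x y}" "u \<longlonglongrightarrow> x"
      then obtain v where v: "\<And>n. G (u n) (v n)" by auto metis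
      have "Cauchy v"
      proof (rule metric_CauchyI)
        fix \<epsilon> :: real assume "\<epsilon> > 0"
        \<comment> \<open>The added 1 keeps the divisor positive when
          \<open>\<kappa> = 0\<close>.\<close>
        define s where "s = sqrt \<bar>\<kappa>\<bar> + 1"
        have "s > 0" by (simp add: s_def add_nonneg_pos)
        obtain N where N: "\<And>m n. m \<ge> N \<Longrightarrow> n \<ge> N \<Longrightarrow> dist (u m) (u n) < \<epsilon> / s"
          using metric_CauchyD[OF LIMSEQ_imp_Cauchy[OF u(2)], of "\<epsilon> / s"] \<open>\<epsilon> > 0\<close> \<open>s > 0\<close> by auto
        show "\<exists>N. \<forall>m\<ge>N. \<forall>n\<ge>N. dist (v m) (v n) < \<epsilon>"
        proof (intro exI[of _ N] allI impI)
          fix m n assume mn: "m \<ge> N" "n \<ge> N"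
          have "dist (v m) (v n) \<le> dist (u m) (u n) * sqrt \<bar>\<kappa>\<bar>"
            using G_bound[OF G_diff[OF v v]] by (simp add: dist_norm)
          also have "\<dots> \<le> dist (u m) (u n) * s"
            by (intro mult_left_mono) (simp_all add: s_def)
          also have "\<dots> < \<epsilon>"
            using N[OF mn] \<open>s > 0\<close> by (simp add: field_simps)
          finally show "dist (v m) (v n) < \<epsilon>" .
        qed
      qed
      then obtain y where "v \<longlonglongrightarrow> y"
        using Cauchy_convergent convergent_def by blast
      with v u(2) have "G x y"
        unfolding G_def by (rule graph_closure.lim)
      then show "\<exists>y. G x y" ..
    qed
    show "e ` I \<subseteq> {x. \<exists>y. G x y}"
      by (auto simp: G_def P_def intro!: exI graph_closure.base)
    show "0 \<in> {x. \<exists>y. G x y}"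
      by (auto simp: G_def intro!: exI graph_closure.zero)
  qed (use G_add G_scale in blast)+
  then obtain A where A: "\<And>x. G x (A x)" by (auto simp: set_eq_iff) metis
  have "bounded_linear A"
  proof (rule bounded_linear_intro)
    show "A (x + y) = A x + A y" for x y
      using G_unique A G_add by blast
    show "A (r *\<^sub>R x) = r *\<^sub>R A x" for r x
      using G_unique[OF A G_scale[OF A, of "complex_of_real r" x, unfolded scaleC_of_real]] .
    show "norm (A x) \<le> norm x * sqrt \<bar>\<kappa>\<bar>" for x
      using A by (rule G_bound)
  qed
  moreover have "A (c *\<^sub>C x) = c *\<^sub>C A x" for c x
    using G_unique A G_scale by blast
  moreover have "A (e i) = e' i" if "i \<in> I" for i
    using that by (intro G_unique[OF A]) (auto simp: G_def P_def intro!: graph_closure.base)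
  ultimately show "\<exists>A. bounded_clinear A \<and> (\<forall>i\<in>I. A (e i) = e' i)"
    by (auto simp: bounded_clinear_def)
next
  fix A B assume *: "bounded_clinear A \<and> (\<forall>i\<in>I. A (e i) = e' i)"
    "bounded_clinear B \<and> (\<forall>i\<in>I. B (e i) = e' i)"
  show "A = B"
    by (rule bounded_clinear_total_eqI[OF total]) (use * in auto)
qed

text \<open>Bessel's inequality for the mutually orthogonal ranges of the isometries \<open>A n\<close>.\<close>

lemma orthogonal_isometries_cadjoint_tendsto_0:
  fixes A :: "nat \<Rightarrow> 'h::complex_hilbert \<Rightarrow> 'h"
  assumes bdd: "\<And>n. bounded_clinear (A n)"
    and orth: "\<And>m n v. cadjoint (A m) (A n v) = (if m = n then v else 0)"
  shows "(\<lambda>n. cadjoint (A n) v) \<longlonglongrightarrow> 0"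
proof -
  have "(\<Sum>n<N. (norm (cadjoint (A n) v))\<^sup>2) \<le> (norm v)\<^sup>2" for N
  proof -
    \<comment> \<open>The projection of \<open>v\<close> onto the sum of the first \<open>N\<close>
      ranges. Both \<open>cinner w v\<close> and \<open>cinner w w\<close> equal the partial sum
      \<open>b\<close>, so Cauchy-Schwarz yields \<open>norm w \<le> norm v\<close>.\<close>
    define w where "w = (\<Sum>n<N. A n (cadjoint (A n) v))"
    define b where "b = (\<Sum>n<N. (norm (cadjoint (A n) v))\<^sup>2)"
    have w_adj: "cadjoint (A n) w = cadjoint (A n) v" if "n < N" for n
      using that unfolding w_def bounded_clinearD(7)[OF bounded_clinear_cadjoint[OF bdd]] orth
      by (simp add: sum.delta)
    have wv: "cinner w v = complex_of_real b"
      unfolding w_def b_def cinner_sum_left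
      by (simp add: cadjoint_cinner_right[OF bdd, symmetric] cinner_self)
    have "cinner w w = (\<Sum>n<N. cinner (cadjoint (A n) v) (cadjoint (A n) w))"
      by (subst w_def) (simp add: cinner_sum_left cadjoint_cinner_right[OF bdd])
    also have "\<dots> = complex_of_real b"
      by (simp add: w_adj b_def cinner_self)
    finally have ww: "(norm w)\<^sup>2 = b"
      unfolding cinner_self of_real_eq_iff .
    have "norm w * norm w \<le> norm w * norm v"
      using norm_cinner_le[of w v] unfolding wv ww[symmetric] by (simp add: power2_eq_square norm_mult)
    then have "norm w \<le> norm v"
      by (cases "w = 0") simp_all
    then have "(norm w)\<^sup>2 \<le> (norm v)\<^sup>2" by (simp add: power_mono)
    then show ?thesis by (simp add: ww b_def)
  qed
  then have "summable (\<lambda>n. (norm (cadjoint (A n) v))\<^sup>2)"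
    by (intro summableI_nonneg_bounded) auto
  from tendsto_real_sqrt[OF summable_LIMSEQ_zero[OF this]]
  have "(\<lambda>n. norm (cadjoint (A n) v)) \<longlonglongrightarrow> 0" by simp
  then show ?thesis by (rule tendsto_norm_zero_cancel)
qed

section \<open>Commutants and the standard form\<close>

lemma commutantD:
  "T \<in> commutant X \<Longrightarrow> bounded_clinear T"
  "T \<in> commutant X \<Longrightarrow> A \<in> X \<Longrightarrow> T (A v) = A (T v)"
  by (auto simp: commutant_def fun_eq_iff)

lemma commutantI:
  "bounded_clinear T \<Longrightarrow> (\<And>A v. A \<in> X \<Longrightarrow> T (A v) = A (T v)) \<Longrightarrow> T \<in> commutant X"
  by (auto simp: commutant_def fun_eq_iff)

lemma commutant_antimono: "X \<subseteq> Y \<Longrightarrow> commutant Y \<subseteq> commutant X"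
  by (auto simp: commutant_def)

lemma subset_double_commutant:
  "(\<And>A. A \<in> X \<Longrightarrow> bounded_clinear A) \<Longrightarrow> X \<subseteq> commutant (commutant X)"
  by (auto simp: commutant_def)

text \<open>Consequently a double commutant is its own bicommutant, and its commutant is already
  that of the generators.\<close>

lemma triple_commutant:
  assumes "\<And>A. A \<in> X \<Longrightarrow> bounded_clinear A"
  shows "commutant (commutant (commutant X)) = commutant X"
proof (rule subset_antisym)
  show "commutant (commutant (commutant X)) \<subseteq> commutant X"
    by (intro commutant_antimono subset_double_commutant assms)
  show "commutant X \<subseteq> commutant (commutant (commutant X))"
    by (rule subset_double_commutant) (rule commutantD)
qed

lemma id_mem_commutant: "id \<in> commutant X"
  by (rule commutantI) (simp_all add: bounded_clinear_id)

lemma comp_mem_commutant: "S \<in> commutant X \<Longrightarrow> T \<in> commutant X \<Longrightarrow> S \<circ> T \<in> commutant X"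
  by (rule commutantI) (simp_all add: bounded_clinear_comp commutantD)

lemma add_mem_commutant:
  assumes "\<And>A. A \<in> X \<Longrightarrow> bounded_clinear A" "S \<in> commutant X" "T \<in> commutant X"
  shows "(\<lambda>v. S v + T v) \<in> commutant X"
  using assms
  by (intro commutantI bounded_clinear_add) (auto simp: commutantD bounded_clinearD(3))

lemma scaleC_mem_commutant:
  assumes "\<And>A. A \<in> X \<Longrightarrow> bounded_clinear A" "T \<in> commutant X"
  shows "(\<lambda>v. c *\<^sub>C T v) \<in> commutant X"
  using assms
  by (intro commutantI bounded_clinear_scaleC) (auto simp: commutantD bounded_clinearD(2))

lemma cadjoint_mem_commutant:
  assumes "\<And>A. A \<in> X \<Longrightarrow> bounded_clinear A" "\<And>A. A \<in> X \<Longrightarrow> cadjoint A \<in> X"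
    and "T \<in> commutant X"
  shows "cadjoint T \<in> commutant X"
proof (rule commutantI)
  have T: "bounded_clinear T" using assms(3) by (rule commutantD)
  then show "bounded_clinear (cadjoint T)" by (rule bounded_clinear_cadjoint)
  fix A v assume "A \<in> X"
  then have A: "bounded_clinear A" "bounded_clinear (cadjoint A)" "cadjoint A \<in> X"
    using assms bounded_clinear_cadjoint by blast+
  show "cadjoint T (A v) = A (cadjoint T v)"
  proof (rule cinner_eqI)
    fix x
    have "cinner x (cadjoint T (A v)) = cinner (cadjoint A (T x)) v"
      by (simp add: cadjoint_cinner_right cadjoint_cinner_left T A)
    also have "\<dots> = cinner (T (cadjoint A x)) v"
      by (simp add: commutantD(2)[OF assms(3) A(3)])
    also have "\<dots> = cinner x (A (cadjoint T v))"
      by (simp add: cadjoint_cinner_right[OF T, symmetric] cadjoint_cinner_left A)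
    finally show "cinner x (cadjoint T (A v)) = cinner x (A (cadjoint T v))" .
  qed
qed

text \<open>Polarising the norm identity preserves the real inner product; conjugate linearity at
  \<open>\<i>\<close> then flips the sign of the imaginary part.\<close>

lemma conjugation_isometry_cinner:
  assumes add: "\<And>u v. J (u + v) = J u + J v" and scale: "\<And>c v. J (c *\<^sub>C v) = cnj c *\<^sub>C J v"
    and norm: "\<And>v. norm (J v) = norm v"
  shows "cinner (J u) (J v) = cinner v u"
proof -
  have re: "inner (J u) (J v) = inner u v" for u v
  proof -
    have "(norm (J (u + v)))\<^sup>2 = (norm (u + v))\<^sup>2" by (simp add: norm)
    then have "inner (J u) (J u) + 2 * inner (J u) (J v) + inner (J v) (J v) =
        inner u u + 2 * inner u v + inner v v"
      by (simp add: add power2_norm_eq_inner inner_add_left inner_add_right inner_commute)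
    then show ?thesis
      by (simp add: power2_norm_eq_inner[symmetric] norm)
  qed
  have "J (\<i> *\<^sub>C v) = - (\<i> *\<^sub>C J v)"
    using scale[of \<i> v] by (simp add: complex_vector.scale_minus_left)
  then have "cinner (J u) (J v) = cnj (cinner u v)"
    using re[of u v] re[of u "\<i> *\<^sub>C v"] by (simp add: cinner_eq_Complex complex_eq_iff)
  then show ?thesis by (metis cinner_commute)
qed

section \<open>Modular conjugation and commutant for a trace vector\<close>

text \<open>Traciality enters through \<open>J\<close>: an isometry with
  \<open>J (x \<Omega>) = cadjoint x \<Omega>\<close> forces \<open>x \<Omega>\<close> and
  \<open>cadjoint x \<Omega>\<close> to have equal norm. That \<open>\<Omega>\<close> is separating
  is implicit in \<open>commutant_cyclic\<close> below.\<close>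

locale standard_form =
  fixes M :: "('h::complex_hilbert \<Rightarrow> 'h) set" and \<Omega> :: 'h and J :: "'h \<Rightarrow> 'h"
  assumes bounded: "x \<in> M \<Longrightarrow> bounded_clinear x"
    and adjoint_mem: "x \<in> M \<Longrightarrow> cadjoint x \<in> M"
    and bicommutant: "commutant (commutant M) = M"
    and cyclic: "closure ((\<lambda>x. x \<Omega>) ` M) = UNIV"
    and J: "modular_conjugation M \<Omega> J"
begin

lemma J_add: "J (u + v) = J u + J v"
  and J_scaleC: "J (c *\<^sub>C v) = cnj c *\<^sub>C J v"
  and J_norm: "norm (J v) = norm v"
  and J_J [simp]: "J (J v) = v"
  and J_apply: "x \<in> M \<Longrightarrow> J (x \<Omega>) = cadjoint x \<Omega>"
  using J by (auto simp: modular_conjugation_def fun_eq_iff)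

lemma J_cinner: "cinner (J u) (J v) = cinner v u"
  by (rule conjugation_isometry_cinner) (rule J_add J_scaleC J_norm)+

lemma bounded_linear_J: "bounded_linear J"
proof (rule bounded_linear_intro)
  show "J (r *\<^sub>R x) = r *\<^sub>R J x" for r x
    using J_scaleC[of "complex_of_real r" x] by (simp add: scaleC_of_real)
  show "norm (J x) \<le> norm x * 1" for x by (simp add: J_norm)
qed (rule J_add)

lemma bounded_clinear_J_conj:
  assumes "bounded_clinear x"
  shows "bounded_clinear (J \<circ> x \<circ> J)"
  unfolding bounded_clinear_def
  using bounded_linear_compose[OF bounded_linear_J
      bounded_linear_compose[OF bounded_clinearD(1)[OF assms] bounded_linear_J]]
  by (simp add: o_def J_scaleC bounded_clinearD(2)[OF assms])

lemma id_mem: "id \<in> M"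
  using id_mem_commutant[of "commutant M"] by (simp only: bicommutant)

lemma comp_mem: "x \<in> M \<Longrightarrow> y \<in> M \<Longrightarrow> x \<circ> y \<in> M"
  using comp_mem_commutant[of x "commutant M" y] by (simp only: bicommutant)

lemma J_vacuum: "J \<Omega> = \<Omega>"
  using J_apply[OF id_mem] by (simp add: cadjoint_id)

lemma eq_on_vacuum:
  assumes "bounded_clinear A" "bounded_clinear B" "\<And>x. x \<in> M \<Longrightarrow> A (x \<Omega>) = B (x \<Omega>)"
  shows "A = B"
  by (rule bounded_clinear_dense_eqI[OF cyclic]) (use assms in auto)

text \<open>Stated for a general \<open>A\<close> because it is needed for \<open>M\<close> and then again for its commutant,
  where it gives \<open>J M' J \<subseteq> M\<close>.\<close>

lemma J_conj_mem_commutant: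
  assumes bdd: "\<And>x. x \<in> A \<Longrightarrow> bounded_clinear x"
    and adj: "\<And>x. x \<in> A \<Longrightarrow> cadjoint x \<in> A"
    and comp: "\<And>x y. x \<in> A \<Longrightarrow> y \<in> A \<Longrightarrow> x \<circ> y \<in> A"
    and dense: "closure ((\<lambda>x. x \<Omega>) ` A) = UNIV"
    and J_A: "\<And>x. x \<in> A \<Longrightarrow> J (x \<Omega>) = cadjoint x \<Omega>"
    and x: "x \<in> A"
  shows "J \<circ> x \<circ> J \<in> commutant A"
proof (rule commutantI)
  show bx: "bounded_clinear (J \<circ> x \<circ> J)"
    using bdd x by (blast intro: bounded_clinear_J_conj)
  \<comment> \<open>On the orbit of \<open>\<Omega>\<close>, conjugating \<open>x\<close> by
    \<open>J\<close> gives right multiplication by \<open>cadjoint x\<close>, which commutes with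
    left multiplications.\<close>
  have act: "(J \<circ> x \<circ> J) (y \<Omega>) = y (cadjoint x \<Omega>)" if "y \<in> A" for y
  proof -
    have "(J \<circ> x \<circ> J) (y \<Omega>) = J ((x \<circ> cadjoint y) \<Omega>)"
      using that by (simp add: J_A)
    also have "\<dots> = (cadjoint (x \<circ> cadjoint y)) \<Omega>"
      using that x by (intro J_A comp adj)
    finally show ?thesis
      using that x by (simp add: cadjoint_comp cadjoint_cadjoint bdd adj)
  qed
  fix y v assume y: "y \<in> A"
  have "(J \<circ> x \<circ> J) \<circ> y = y \<circ> (J \<circ> x \<circ> J)"
  proof (rule bounded_clinear_dense_eqI[OF dense])
    show "bounded_clinear ((J \<circ> x \<circ> J) \<circ> y)" "bounded_clinear (y \<circ> (J \<circ> x \<circ> J))"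
      using bx bdd[OF y] by (blast intro: bounded_clinear_comp)+
    fix v assume "v \<in> (\<lambda>x. x \<Omega>) ` A"
    then obtain z where z: "z \<in> A" "v = z \<Omega>" by blast
    show "((J \<circ> x \<circ> J) \<circ> y) v = (y \<circ> (J \<circ> x \<circ> J)) v"
      using act[OF z(1)] act[OF comp[OF y z(1)]] by (simp add: z(2))
  qed
  from fun_cong[OF this, of v] show "(J \<circ> x \<circ> J) (y v) = y ((J \<circ> x \<circ> J) v)"
    by simp
qed

lemma J_conj_M: "x \<in> M \<Longrightarrow> J \<circ> x \<circ> J \<in> commutant M"
  by (rule J_conj_mem_commutant) (use bounded adjoint_mem comp_mem cyclic J_apply in auto)

text \<open>For \<open>x\<close> in \<open>M\<close> the vector \<open>x \<Omega>\<close> is also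
  \<open>(J \<circ> cadjoint x \<circ> J) \<Omega>\<close>, the value of an element of the
  commutant.\<close>

lemma commutant_cyclic: "closure ((\<lambda>x. x \<Omega>) ` commutant M) = UNIV"
proof -
  have "x \<Omega> \<in> (\<lambda>x. x \<Omega>) ` commutant M" if "x \<in> M" for x
    using J_conj_M[OF adjoint_mem[OF that]]
    by (rule rev_image_eqI)
      (simp add: J_vacuum J_apply that adjoint_mem cadjoint_cadjoint bounded)
  then have "closure ((\<lambda>x. x \<Omega>) ` M) \<subseteq> closure ((\<lambda>x. x \<Omega>) ` commutant M)"
    by (intro closure_mono) auto
  with cyclic show ?thesis by auto
qed

text \<open>Provides the hypothesis \<open>J_A\<close> of \<open>J_conj_mem_commutant\<close> for
  the commutant. Paired with \<open>x \<Omega>\<close>, both sides become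
  \<open>cinner (m (x \<Omega>)) \<Omega>\<close>: move \<open>x\<close> across the inner product
  and commute it with \<open>m\<close>.\<close>

lemma J_apply_commutant:
  assumes "m \<in> commutant M"
  shows "J (m \<Omega>) = cadjoint m \<Omega>"
proof (rule total_cinner_eqI)
  show "closure (complex_vector.span ((\<lambda>x. x \<Omega>) ` M)) = UNIV"
    using closure_mono[OF complex_vector.span_superset] cyclic by blast
  fix v assume "v \<in> (\<lambda>x. x \<Omega>) ` M"
  then obtain x where x: "x \<in> M" "v = x \<Omega>" by blast
  have m: "bounded_clinear m" using assms by (rule commutantD)
  have "cinner v (J (m \<Omega>)) = cinner (m \<Omega>) (J v)"
    using J_cinner[of "J v" "m \<Omega>"] by simp
  also have "\<dots> = cinner (x (m \<Omega>)) \<Omega>"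
    using x by (simp add: J_apply cadjoint_cinner_right bounded)
  also have "\<dots> = cinner (m v) \<Omega>"
    using commutantD(2)[OF assms x(1), of \<Omega>] x(2) by simp
  finally show "cinner v (J (m \<Omega>)) = cinner v (cadjoint m \<Omega>)"
    by (simp add: cadjoint_cinner_right m)
qed

lemma J_conj_commutant:
  assumes "m \<in> commutant M"
  shows "J \<circ> m \<circ> J \<in> M"
proof -
  have "J \<circ> m \<circ> J \<in> commutant (commutant M)"
  proof (rule J_conj_mem_commutant)
    show "cadjoint x \<in> commutant M" if "x \<in> commutant M" for x
      using that by (intro cadjoint_mem_commutant bounded adjoint_mem)
  qed (simp_all only: commutantD(1) comp_mem_commutant commutant_cyclic J_apply_commutant assms)
  then show ?thesis by (simp only: bicommutant)
qed

text \<open>Both operators lie in the commutant and agree at \<open>\<Omega>\<close>, which is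
  cyclic for \<open>M\<close>. This is how the \<open>J\<close>-conjugate of a semicircular operator
  gets identified.\<close>

lemma J_conj_eqI:
  assumes "x \<in> M" "cadjoint x = x" "y \<in> commutant M" "x \<Omega> = y \<Omega>"
  shows "J \<circ> x \<circ> J = y"
proof (rule eq_on_vacuum)
  show "bounded_clinear (J \<circ> x \<circ> J)" "bounded_clinear y"
    using J_conj_M assms commutantD(1) by blast+
  fix z assume z: "z \<in> M"
  have "(J \<circ> x \<circ> J) (z \<Omega>) = z ((J \<circ> x \<circ> J) \<Omega>)"
    using J_conj_M assms(1) z by (blast dest: commutantD(2))
  also have "\<dots> = z (y \<Omega>)"
    using J_apply[OF assms(1)] assms(2,4) by (simp add: J_vacuum)
  finally show "(J \<circ> x \<circ> J) (z \<Omega>) = y (z \<Omega>)"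
    using commutantD(2)[OF assms(3) z] by simp
qed

end

section \<open>Square-integrable functions on the half-line\<close>

lemma complexification_inner_Re: "Re (complexification_inner u v) = inner u v"
  by (simp add: complexification_inner_def inner_prod_def)

text \<open>The pair \<open>(snd v, - fst v)\<close> stands for \<open>- \<i> v\<close>.
  Measurability and bounds for the complex pairing thus come from the real inner product.\<close>

lemma complexification_inner_Im: "Im (complexification_inner u v) = inner u (snd v, - fst v)"
  by (simp add: complexification_inner_def inner_prod_def inner_commute)

lemma integrable_complexification_inner:
  fixes f g :: "real \<Rightarrow> 'k::{real_inner, second_countable_topology} \<times> 'k"
  assumes "f \<in> L2_fun" "g \<in> L2_fun"
  shows "integrable half_line (\<lambda>s. complexification_inner (f s) (g s))"
proof (rule Bochner_Integration.integrable_bound)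
  have f: "f \<in> borel_measurable half_line" and g: "g \<in> borel_measurable half_line"
    using assms by (auto simp: L2_fun_def)
  have "(\<lambda>s. fst (g s)) \<in> borel_measurable half_line"
    "(\<lambda>s. snd (g s)) \<in> borel_measurable half_line"
    by (auto intro!: borel_measurable_continuous_on[OF _ g] continuous_intros)
  with f g show "(\<lambda>s. complexification_inner (f s) (g s)) \<in> borel_measurable half_line"
    unfolding borel_measurable_complex_iff complexification_inner_Re complexification_inner_Im
    by (auto intro!: borel_measurable_inner borel_measurable_Pair)
  show "integrable half_line (\<lambda>s. 2 * ((norm (f s))\<^sup>2 + (norm (g s))\<^sup>2))"
    using assms by (auto simp: L2_fun_def)
  have "norm (complexification_inner u v) \<le> 2 * ((norm u)\<^sup>2 + (norm v)\<^sup>2)" for u v :: "'k \<times> 'k"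
  proof -
    have "norm (complexification_inner u v) \<le> \<bar>inner u v\<bar> + \<bar>inner u (snd v, - fst v)\<bar>"
      using cmod_le by (metis complexification_inner_Re complexification_inner_Im)
    also have "\<dots> \<le> norm u * norm v + norm u * norm (snd v, - fst v)"
      by (intro add_mono Cauchy_Schwarz_ineq2)
    also have "\<dots> = 2 * (norm u * norm v)"
      by (simp add: norm_Pair norm_prod_def add.commute)
    also have "\<dots> \<le> 2 * ((norm u)\<^sup>2 + (norm v)\<^sup>2)"
    proof (rule order_trans)
      show "2 * (norm u * norm v) \<le> 1 * ((norm u)\<^sup>2 + (norm v)\<^sup>2)"
        using sum_squares_bound[of "norm u" "norm v"] by (simp add: mult.assoc)
    qed (rule mult_right_mono, simp_all)
    finally show ?thesis .
  qed
  then show "AE s in half_line. norm (complexification_inner (f s) (g s))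
      \<le> norm (2 * ((norm (f s))\<^sup>2 + (norm (g s))\<^sup>2))"
    by (intro AE_I2) (metis abs_of_nonneg add_nonneg_nonneg mult_nonneg_nonneg real_norm_def
        zero_le_numeral zero_le_power2)
qed

lemma complexify_mem_L2_fun:
  fixes f :: "real \<Rightarrow> 'k::{real_inner, second_countable_topology}"
  assumes "f \<in> L2_fun"
  shows "complexify f \<in> L2_fun"
  using assms by (auto simp: L2_fun_def complexify_def norm_Pair intro!: borel_measurable_Pair)

lemma fst_snd_mem_L2_fun:
  fixes f :: "real \<Rightarrow> 'k::{real_inner, second_countable_topology} \<times> 'k"
  assumes "f \<in> L2_fun"
  shows "(\<lambda>s. fst (f s)) \<in> L2_fun" "(\<lambda>s. snd (f s)) \<in> L2_fun"
proof -
  have f: "f \<in> borel_measurable half_line" "integrable half_line (\<lambda>s. (norm (f s))\<^sup>2)"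
    using assms by (auto simp: L2_fun_def)
  have meas: "(\<lambda>s. fst (f s)) \<in> borel_measurable half_line"
    "(\<lambda>s. snd (f s)) \<in> borel_measurable half_line"
    by (auto intro!: borel_measurable_continuous_on[OF _ f(1)] continuous_intros)
  have le: "norm (fst (f s)) \<le> norm (f s)" "norm (snd (f s)) \<le> norm (f s)" for s
    using norm_fst_le[of "fst (f s)" "snd (f s)"] norm_snd_le[of "snd (f s)" "fst (f s)"] by simp_all
  have "integrable half_line (\<lambda>s. (norm (fst (f s)))\<^sup>2)"
    using meas by (intro Bochner_Integration.integrable_bound[OF f(2)]) (simp_all add: le power_mono)
  moreover have "integrable half_line (\<lambda>s. (norm (snd (f s)))\<^sup>2)"
    using meas by (intro Bochner_Integration.integrable_bound[OF f(2)]) (simp_all add: le power_mono)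
  ultimately show "(\<lambda>s. fst (f s)) \<in> L2_fun" "(\<lambda>s. snd (f s)) \<in> L2_fun"
    using meas by (auto simp: L2_fun_def)
qed

text \<open>The pairing is conjugate-linear on the left, hence the factor
  \<open>cnj \<i>\<close>.\<close>

lemma L2_inner_decompose_left:
  fixes f g :: "real \<Rightarrow> 'k::{real_inner, second_countable_topology} \<times> 'k"
  assumes "f \<in> L2_fun" "g \<in> L2_fun"
  shows "L2_inner f g = L2_inner (complexify (\<lambda>s. fst (f s))) g
    + cnj \<i> * L2_inner (complexify (\<lambda>s. snd (f s))) g"
proof -
  have *: "complexification_inner (f s) (g s) =
      complexification_inner (complexify (\<lambda>s. fst (f s)) s) (g s)
      + cnj \<i> * complexification_inner (complexify (\<lambda>s. snd (f s)) s) (g s)" for s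
    by (simp add: complexification_inner_def complexify_def complex_eq_iff)
  show ?thesis
    unfolding L2_inner_def * using assms
    by (subst Bochner_Integration.integral_add)
      (auto intro!: integrable_complexification_inner complexify_mem_L2_fun fst_snd_mem_L2_fun)
qed

lemma L2_inner_complexify:
  "L2_inner (complexify f) (complexify g) = complex_of_real (\<integral>s. inner (f s) (g s) \<partial>half_line)"
proof -
  have "complexification_inner (complexify f s) (complexify g s) = complex_of_real (inner (f s) (g s))"
    for s by (simp add: complexification_inner_def complexify_def complex_eq_iff)
  then show ?thesis by (simp add: L2_inner_def)
qed

section \<open>An orthonormal sequence from disjoint time intervals\<close>

text \<open>A half-open interval of length one: integer translates are disjoint, and a unit vector
  \<open>x\<close> gives a function of norm one.\<close>

definition bump :: "real \<Rightarrow> 'v \<Rightarrow> real \<Rightarrow> 'v::real_inner" where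
  "bump a x = (\<lambda>s. indicator {a..<a + 1} s *\<^sub>R x)"

lemma half_line_indicator:
  assumes "0 \<le> a" "a \<le> b"
  shows "integrable half_line (indicator {a..<b} :: real \<Rightarrow> real)"
    "integral\<^sup>L half_line (indicator {a..<b} :: real \<Rightarrow> real) = b - a"
proof -
  have *: "(\<lambda>s::real. indicator {0..} s * (indicator {a..<b} s :: real)) = indicator {a..<b}"
    using assms by (auto simp: indicator_def fun_eq_iff)
  show "integrable half_line (indicator {a..<b} :: real \<Rightarrow> real)"
    unfolding half_line_def
    by (subst integrable_restrict_space) (use assms in \<open>auto simp: * set_integrable_def\<close>)
  show "integral\<^sup>L half_line (indicator {a..<b} :: real \<Rightarrow> real) = b - a"
    unfolding half_line_def
    by (subst integral_restrict_space) (use assms in \<open>auto simp: * set_lebesgue_integral_def\<close>)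
qed

lemma bump_mem_L2_fun:
  fixes x :: "'v::{real_inner, second_countable_topology}"
  assumes "0 \<le> a"
  shows "bump a x \<in> L2_fun"
proof -
  have "(norm (bump a x s))\<^sup>2 = indicator {a..<a + 1} s * (norm x)\<^sup>2" for s
    by (simp add: bump_def indicator_def)
  moreover have "integrable half_line (\<lambda>s. indicator {a..<a + 1} s *\<^sub>R x)"
    using half_line_indicator(1)[of a "a + 1"] assms by (intro integrable_scaleR_left) auto
  then have "bump a x \<in> borel_measurable half_line"
    unfolding bump_def by (rule borel_measurable_integrable)
  ultimately show ?thesis
    using half_line_indicator(1)[of a "a + 1"] assms by (simp add: L2_fun_def)
qed

text \<open>As \<open>a\<close> is nonnegative, the bump is zero at negative times, which are the
  ones that \<open>shift\<close> cuts off.\<close>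

lemma shift_bump: "0 \<le> a \<Longrightarrow> shift t (bump a x) = bump (t + a) x"
  by (auto simp: shift_def bump_def indicator_def fun_eq_iff)

lemma L2_inner_bump:
  assumes "0 \<le> a" "norm x = 1"
  shows "L2_inner (complexify (bump (a + real m) x)) (complexify (bump (a + real n) x)) =
    (if m = n then 1 else 0)"
proof -
  have "inner (bump (a + real m) x s) (bump (a + real n) x s) =
      (if m = n then indicator {a + real m..<a + real m + 1} s else 0)" for s
  proof (cases "m = n")
    case True
    then show ?thesis
      using assms(2) by (simp add: bump_def indicator_def norm_eq_sqrt_inner)
  next
    case False
    then have "real m + 1 \<le> real n \<or> real n + 1 \<le> real m" by linarith
    with False show ?thesis by (auto simp: bump_def indicator_def)
  qed
  moreover have "(\<integral>s. indicator {a + real m..<a + real m + 1} s \<partial>half_line) = (1 :: real)"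
    using half_line_indicator(2)[of "a + real m" "a + real m + 1"] assms(1) by simp
  ultimately show ?thesis
    by (cases "m = n") (simp_all only: L2_inner_complexify if_True if_False refl of_real_1
        of_real_0 Bochner_Integration.integral_zero)
qed

section \<open>Creation and annihilation operators\<close>

locale fock_space =
  fixes ten :: "(real \<Rightarrow> 'k::{real_inner, banach, second_countable_topology} \<times> 'k) list \<Rightarrow>
      'h::complex_hilbert"
  assumes fock: "full_fock_space ten"
begin

abbreviation tensors :: "(real \<Rightarrow> 'k \<times> 'k) list set" where
  "tensors \<equiv> lists L2_fun"

text \<open>Mirror image of \<open>creation\<close>, used to write down elements of the commutant
  explicitly.\<close>

definition right_creation :: "(real \<Rightarrow> 'k \<times> 'k) \<Rightarrow> 'h \<Rightarrow> 'h" where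
  "right_creation f =
    (THE A. bounded_clinear A \<and> (\<forall>fs\<in>tensors. A (ten fs) = ten (fs @ [f])))"

abbreviation "lc \<equiv> creation ten"
abbreviation "rc \<equiv> right_creation"
abbreviation "la f \<equiv> cadjoint (creation ten f)"
abbreviation "ra f \<equiv> cadjoint (right_creation f)"

lemma cinner_ten:
  "fs \<in> tensors \<Longrightarrow> gs \<in> tensors \<Longrightarrow> cinner (ten fs) (ten gs) =
    (if length fs = length gs then prod_list (map2 L2_inner fs gs) else 0)"
  using fock by (simp add: full_fock_space_def)

lemma total: "closure (module.span scaleC (ten ` tensors)) = UNIV"
  using fock by (simp add: full_fock_space_def)

lemma ten_eqI:
  "(\<And>fs. fs \<in> tensors \<Longrightarrow> cinner (ten fs) u = cinner (ten fs) v) \<Longrightarrow> u = v"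
  by (rule total_cinner_eqI[OF total]) auto

lemma op_eqI:
  assumes "bounded_clinear A" "bounded_clinear B"
    and "\<And>fs. fs \<in> tensors \<Longrightarrow> A (ten fs) = B (ten fs)"
  shows "A = B"
  by (rule bounded_clinear_total_eqI[OF total]) (use assms in auto)

lemma L2_inner_eq_cinner: "f \<in> L2_fun \<Longrightarrow> g \<in> L2_fun \<Longrightarrow> L2_inner f g = cinner (ten [f]) (ten [g])"
  by (simp add: cinner_ten)

lemma cinner_vacuum: "cinner (ten []) (ten []) = 1"
  by (simp add: cinner_ten)

lemma cinner_ten_Cons:
  assumes "f \<in> L2_fun" "g \<in> L2_fun" "fs \<in> tensors" "gs \<in> tensors"
  shows "cinner (ten (f # fs)) (ten (g # gs)) = L2_inner f g * cinner (ten fs) (ten gs)"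
  using assms by (simp add: cinner_ten)

lemma cinner_ten_snoc:
  assumes "f \<in> L2_fun" "g \<in> L2_fun" "fs \<in> tensors" "gs \<in> tensors"
  shows "cinner (ten (fs @ [f])) (ten (gs @ [g])) = L2_inner f g * cinner (ten fs) (ten gs)"
  using assms by (simp add: cinner_ten)

lemma L2_inner_self: "f \<in> L2_fun \<Longrightarrow> L2_inner f f = complex_of_real ((norm (ten [f]))\<^sup>2)"
  by (simp add: L2_inner_eq_cinner cinner_self)

text \<open>Prefixing \<open>f\<close> multiplies the Gram matrix of the elementary tensors by the
  squared norm of \<open>f\<close>, so by \<open>gram_extension\<close> the definite description
  denotes.\<close>

lemma
  assumes "f \<in> L2_fun"
  shows creation_bounded: "bounded_clinear (lc f)"
    and creation_ten: "fs \<in> tensors \<Longrightarrow> lc f (ten fs) = ten (f # fs)"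
proof -
  have "\<exists>!A. bounded_clinear A \<and> (\<forall>fs\<in>tensors. A (ten fs) = ten (f # fs))"
    using assms by (intro gram_extension[OF _ total]) (simp only: cinner_ten_Cons L2_inner_self)
  from theI'[OF this] show "bounded_clinear (lc f)" "fs \<in> tensors \<Longrightarrow> lc f (ten fs) = ten (f # fs)"
    by (auto simp: creation_def)
qed

lemma
  assumes "f \<in> L2_fun"
  shows right_creation_bounded: "bounded_clinear (rc f)"
    and right_creation_ten: "fs \<in> tensors \<Longrightarrow> rc f (ten fs) = ten (fs @ [f])"
proof -
  have "\<exists>!A. bounded_clinear A \<and> (\<forall>fs\<in>tensors. A (ten fs) = ten (fs @ [f]))"
    using assms by (intro gram_extension[OF _ total]) (simp only: cinner_ten_snoc L2_inner_self)
  from theI'[OF this] show "bounded_clinear (rc f)" "fs \<in> tensors \<Longrightarrow> rc f (ten fs) = ten (fs @ [f])"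
    by (auto simp: right_creation_def)
qed

lemmas bounded_intros = creation_bounded right_creation_bounded bounded_clinear_cadjoint

text \<open>For orthonormal functions this makes the creation operators isometries with mutually
  orthogonal ranges, the situation of Bessel's inequality.\<close>

lemma annihilation_creation:
  assumes "f \<in> L2_fun" "g \<in> L2_fun"
  shows "la f (lc g v) = L2_inner f g *\<^sub>C v"
proof -
  have "la f \<circ> lc g = (\<lambda>v. L2_inner f g *\<^sub>C id v)"
  proof (intro op_eqI ten_eqI)
    fix fs gs :: "(real \<Rightarrow> 'k \<times> 'k) list" assume "fs \<in> tensors" "gs \<in> tensors"
    with assms show "cinner (ten gs) ((la f \<circ> lc g) (ten fs))
        = cinner (ten gs) (L2_inner f g *\<^sub>C id (ten fs))"
      by (simp add: cadjoint_cinner_right creation_bounded creation_ten cinner_ten_Cons cinner_simps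
          del: in_lists_conv_set)
  qed (intro bounded_clinear_comp bounded_clinear_scaleC bounded_clinear_id bounded_intros assms)+
  then show ?thesis by (simp add: fun_eq_iff)
qed

lemma right_annihilation_creation:
  assumes "f \<in> L2_fun" "g \<in> L2_fun"
  shows "ra f (rc g v) = L2_inner f g *\<^sub>C v"
proof -
  have "ra f \<circ> rc g = (\<lambda>v. L2_inner f g *\<^sub>C id v)"
  proof (intro op_eqI ten_eqI)
    fix fs gs :: "(real \<Rightarrow> 'k \<times> 'k) list" assume "fs \<in> tensors" "gs \<in> tensors"
    with assms show "cinner (ten gs) ((ra f \<circ> rc g) (ten fs))
        = cinner (ten gs) (L2_inner f g *\<^sub>C id (ten fs))"
      by (simp add: cadjoint_cinner_right right_creation_bounded right_creation_ten cinner_ten_snoc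
          cinner_simps del: in_lists_conv_set)
  qed (intro bounded_clinear_comp bounded_clinear_scaleC bounded_clinear_id bounded_intros assms)+
  then show ?thesis by (simp add: fun_eq_iff)
qed

lemma annihilation_vacuum:
  assumes "f \<in> L2_fun"
  shows "la f (ten []) = 0"
  by (rule ten_eqI)
    (use assms in \<open>simp add: cadjoint_cinner_right creation_bounded creation_ten cinner_ten\<close>)

lemma right_annihilation_vacuum:
  assumes "f \<in> L2_fun"
  shows "ra f (ten []) = 0"
  by (rule ten_eqI)
    (use assms in \<open>simp add: cadjoint_cinner_right right_creation_bounded right_creation_ten cinner_ten\<close>)

lemma annihilation_ten_Cons:
  assumes "f \<in> L2_fun" "g \<in> L2_fun" "gs \<in> tensors"
  shows "la f (ten (g # gs)) = L2_inner f g *\<^sub>C ten gs"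
  using annihilation_creation[OF assms(1,2), of "ten gs"] assms by (simp add: creation_ten)

section \<open>Relations between left and right operators\<close>

lemma creation_right_creation:
  assumes "f \<in> L2_fun" "g \<in> L2_fun"
  shows "lc f (rc g v) = rc g (lc f v)"
proof -
  have "lc f \<circ> rc g = rc g \<circ> lc f"
    by (intro op_eqI bounded_clinear_comp bounded_intros assms)
      (use assms in \<open>simp add: creation_ten right_creation_ten\<close>)
  from fun_cong[OF this, of v] show ?thesis by simp
qed

text \<open>Removing the first factor and appending a last one commute on nonempty tensors. On the
  vacuum the appended factor is itself the one removed, which leaves a rank-one correction.\<close>

lemma annihilation_right_creation:
  assumes "f \<in> L2_fun" "g \<in> L2_fun"
  shows "la f (rc g v) = rc g (la f v) + (L2_inner f g * cinner (ten []) v) *\<^sub>C ten []"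
proof -
  define P where "P v = cinner (ten []) v *\<^sub>C ten []" for v
  have P: "bounded_clinear P"
    unfolding bounded_clinear_def P_def
  proof
    show "bounded_linear (\<lambda>v. cinner (ten []) v *\<^sub>C ten [])"
    proof (rule bounded_linear_intro)
      show "norm (cinner (ten []) v *\<^sub>C ten []) \<le> norm v * (norm (ten []) * norm (ten []))" for v
        using mult_right_mono[OF norm_cinner_le[of "ten []" v], of "norm (ten [])"]
        by (simp add: norm_scaleC mult_ac)
      show "cinner (ten []) (r *\<^sub>R v) *\<^sub>C ten [] = r *\<^sub>R (cinner (ten []) v *\<^sub>C ten [])" for r v
        by (simp add: scaleC_of_real[symmetric] cinner_simps scaleC_scaleC)
    qed (simp add: cinner_simps scaleC_add_left)
  qed (simp add: cinner_simps scaleC_scaleC)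
  have "la f \<circ> rc g = (\<lambda>v. (rc g \<circ> la f) v + L2_inner f g *\<^sub>C P v)"
  proof (intro op_eqI)
    fix fs assume fs: "fs \<in> tensors"
    show "(la f \<circ> rc g) (ten fs) = (rc g \<circ> la f) (ten fs) + L2_inner f g *\<^sub>C P (ten fs)"
    proof (cases fs)
      case Nil
      then show ?thesis using assms
        by (simp add: P_def right_creation_ten annihilation_ten_Cons annihilation_vacuum
            cinner_vacuum bounded_clinearD(5)[OF right_creation_bounded])
    next
      case (Cons h hs)
      then show ?thesis using assms fs
        by (simp add: P_def right_creation_ten annihilation_ten_Cons cinner_ten
            bounded_clinearD(2)[OF right_creation_bounded])
    qed
  qed (intro bounded_clinear_comp bounded_clinear_add bounded_clinear_scaleC bounded_intros assms P)+
  then show ?thesis by (simp add: fun_eq_iff P_def scaleC_scaleC)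
qed

text \<open>The adjoint of \<open>annihilation_right_creation\<close>.\<close>

lemma right_annihilation_creation_left:
  assumes "f \<in> L2_fun" "g \<in> L2_fun"
  shows "ra g (lc f v) = lc f (ra g v) + (L2_inner g f * cinner (ten []) v) *\<^sub>C ten []"
proof (rule cinner_eqI)
  fix u
  have "cinner u (ra g (lc f v)) = cinner (la f (rc g u)) v"
    using assms by (simp add: cadjoint_cinner_right cadjoint_cinner_left bounded_intros)
  also have "\<dots> = cinner (rc g (la f u)) v + cnj (L2_inner f g * cinner (ten []) u) * cinner (ten []) v"
    using assms by (simp add: annihilation_right_creation cinner_simps)
  also have "cnj (L2_inner f g * cinner (ten []) u) = L2_inner g f * cinner u (ten [])"
    using assms by (simp add: L2_inner_eq_cinner cinner_commute[symmetric])
  also have "cinner (rc g (la f u)) v = cinner u (lc f (ra g v))"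
    using assms by (simp add: cadjoint_cinner_right[OF right_creation_bounded, symmetric]
        cadjoint_cinner_left bounded_intros)
  finally show "cinner u (ra g (lc f v))
      = cinner u (lc f (ra g v) + (L2_inner g f * cinner (ten []) v) *\<^sub>C ten [])"
    by (simp add: cinner_simps)
qed

section \<open>The von Neumann algebra of the semicircular operators\<close>

definition right_semicircular :: "(real \<Rightarrow> 'k) \<Rightarrow> 'h \<Rightarrow> 'h" where
  "right_semicircular f = (\<lambda>v. (rc (complexify f) v + ra (complexify f) v) /\<^sub>R 2)"

lemma
  assumes "f \<in> L2_fun"
  shows semicircular_bounded: "bounded_clinear (semicircular ten f)"
    and cadjoint_semicircular: "cadjoint (semicircular ten f) = semicircular ten f"
  using half_sum_adjoint[OF creation_bounded[OF complexify_mem_L2_fun[OF assms]]]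
  unfolding semicircular_def by blast+

lemma right_semicircular_bounded:
  "f \<in> L2_fun \<Longrightarrow> bounded_clinear (right_semicircular f)"
  using half_sum_adjoint(1)[OF right_creation_bounded[OF complexify_mem_L2_fun]]
  unfolding right_semicircular_def by blast

lemma annihilation_right_annihilation:
  assumes "f \<in> L2_fun" "g \<in> L2_fun"
  shows "la f (ra g v) = ra g (la f v)"
proof (rule cinner_eqI)
  fix u
  show "cinner u (la f (ra g v)) = cinner u (ra g (la f v))"
    using assms creation_right_creation[OF assms, of u]
    by (simp add: cadjoint_cinner_right bounded_intros)
qed

text \<open>The only obstructions to commuting are the two vacuum terms, with coefficients
  \<open>L2_inner ?f ?g\<close> and \<open>L2_inner ?g ?f\<close>. They cancel because the pairing
  of real functions is symmetric.\<close>

lemma semicircular_right_semicircular: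
  assumes "f \<in> L2_fun" "g \<in> L2_fun"
  shows "semicircular ten f (right_semicircular g v) = right_semicircular g (semicircular ten f v)"
proof -
  let ?f = "complexify f" and ?g = "complexify g"
  have fg: "?f \<in> L2_fun" "?g \<in> L2_fun"
    using assms by (simp_all add: complexify_mem_L2_fun)
  note lin = bounded_clinearD(3,6)[OF creation_bounded[OF fg(1)]]
    bounded_clinearD(3,6)[OF bounded_clinear_cadjoint[OF creation_bounded[OF fg(1)]]]
    bounded_clinearD(3,6)[OF right_creation_bounded[OF fg(2)]]
    bounded_clinearD(3,6)[OF bounded_clinear_cadjoint[OF right_creation_bounded[OF fg(2)]]]
  have "L2_inner ?f ?g = L2_inner ?g ?f"
    by (simp add: L2_inner_complexify inner_commute)
  then show ?thesis
    unfolding semicircular_def right_semicircular_def lin creation_right_creation[OF fg]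
      annihilation_right_creation[OF fg] annihilation_right_annihilation[OF fg]
      right_annihilation_creation_left[OF fg]
    by (simp add: algebra_simps)
qed

lemma semicircular_vacuum:
  assumes "f \<in> L2_fun"
  shows "semicircular ten f (ten []) = ten [complexify f] /\<^sub>R 2"
    and "right_semicircular f (ten []) = ten [complexify f] /\<^sub>R 2"
  using complexify_mem_L2_fun[OF assms]
  by (simp_all add: semicircular_def right_semicircular_def creation_ten right_creation_ten
      annihilation_vacuum right_annihilation_vacuum)

abbreviation "M \<equiv> free_vN_algebra ten"

lemma generator_bounded: "A \<in> semicircular ten ` L2_fun \<Longrightarrow> bounded_clinear A"
  by (auto simp: semicircular_bounded)

lemma M_bounded: "x \<in> M \<Longrightarrow> bounded_clinear x"
  by (simp add: free_vN_algebra_def commutantD(1))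

lemma semicircular_mem: "f \<in> L2_fun \<Longrightarrow> semicircular ten f \<in> M"
  unfolding free_vN_algebra_def using subset_double_commutant[OF generator_bounded] by blast

lemma right_semicircular_mem_commutant:
  assumes "g \<in> L2_fun"
  shows "right_semicircular g \<in> commutant M"
proof -
  have "right_semicircular g \<in> commutant (semicircular ten ` L2_fun)"
    using assms
    by (intro commutantI) (auto simp: right_semicircular_bounded semicircular_right_semicircular)
  then show ?thesis
    unfolding free_vN_algebra_def by (simp only: triple_commutant[OF generator_bounded])
qed

lemma M_bicommutant: "commutant (commutant M) = M"
  unfolding free_vN_algebra_def by (simp only: triple_commutant[OF generator_bounded])

lemma M_adjoint:
  assumes "x \<in> M"
  shows "cadjoint x \<in> M"
proof -
  have "cadjoint A \<in> semicircular ten ` L2_fun" if "A \<in> semicircular ten ` L2_fun" for A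
    using that by (auto simp: cadjoint_semicircular)
  then have adj: "cadjoint A \<in> commutant (semicircular ten ` L2_fun)"
    if "A \<in> commutant (semicircular ten ` L2_fun)" for A
    using that by (intro cadjoint_mem_commutant[OF generator_bounded])
  show ?thesis
    unfolding free_vN_algebra_def
  proof (rule cadjoint_mem_commutant)
    show "x \<in> commutant (commutant (semicircular ten ` L2_fun))"
      using assms by (simp only: free_vN_algebra_def)
  qed (rule commutantD(1) adj, assumption)+
qed

section \<open>Cyclicity of the vacuum\<close>

definition orbit :: "'h set" where "orbit = (\<lambda>x. x (ten [])) ` M"

lemma orbitI: "x \<in> M \<Longrightarrow> x (ten []) \<in> orbit"
  by (simp add: orbit_def)

lemma vacuum_orbit: "ten [] \<in> orbit"
proof -
  have "id \<in> M" unfolding free_vN_algebra_def by (rule id_mem_commutant)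
  from orbitI[OF this] show ?thesis by simp
qed

lemma orbit_subspace: "complex_vector.subspace orbit"
  unfolding complex_vector.subspace_def
proof (intro conjI ballI allI)
  have N: "bounded_clinear A" if "A \<in> commutant (semicircular ten ` L2_fun)" for A
    using that by (rule commutantD)
  have scale: "(\<lambda>v. c *\<^sub>C x v) \<in> M" if "x \<in> M" for c x
    using scaleC_mem_commutant[OF N, where T = x and c = c] that by (simp only: free_vN_algebra_def)
  have add: "(\<lambda>v. x v + y v) \<in> M" if "x \<in> M" "y \<in> M" for x y
    using add_mem_commutant[OF N, where S = x and T = y] that by (simp only: free_vN_algebra_def)
  show scale': "c *\<^sub>C u \<in> orbit" if "u \<in> orbit" for c u
    using that orbitI[OF scale] unfolding orbit_def by fast
  show "u + v \<in> orbit" if "u \<in> orbit" "v \<in> orbit" for u v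
    using that orbitI[OF add] unfolding orbit_def by fast
  from scale'[OF vacuum_orbit, of 0] show "0 \<in> orbit" by simp
qed

lemma semicircular_orbit:
  assumes "f \<in> L2_fun" "u \<in> orbit"
  shows "semicircular ten f u \<in> orbit"
proof -
  obtain x where x: "x \<in> M" "u = x (ten [])" using assms(2) by (auto simp: orbit_def)
  have "semicircular ten f \<circ> x \<in> M"
    using semicircular_mem[OF assms(1)] x(1) unfolding free_vN_algebra_def
    by (rule comp_mem_commutant)
  from orbitI[OF this] show ?thesis by (simp add: x(2))
qed

text \<open>\<open>full_fock_space\<close> prescribes inner products, so linearity in the first
  factor is read off by pairing with elementary tensors. It reduces complex functions to the real
  ones that label the generators.\<close>

lemma ten_decompose:
  assumes "f \<in> L2_fun" "fs \<in> tensors"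
  shows "ten (f # fs) = ten (complexify (\<lambda>s. fst (f s)) # fs)
    + \<i> *\<^sub>C ten (complexify (\<lambda>s. snd (f s)) # fs)"
proof (rule cinner_eqI)
  fix u
  note parts = fst_snd_mem_L2_fun[OF assms(1), THEN complexify_mem_L2_fun]
  have "ten (f # fs) - ten (complexify (\<lambda>s. fst (f s)) # fs)
      - \<i> *\<^sub>C ten (complexify (\<lambda>s. snd (f s)) # fs) = 0"
  proof (rule ten_eqI)
    fix gs assume gs: "gs \<in> tensors"
    show "cinner (ten gs) (ten (f # fs) - ten (complexify (\<lambda>s. fst (f s)) # fs)
      - \<i> *\<^sub>C ten (complexify (\<lambda>s. snd (f s)) # fs)) = cinner (ten gs) 0"
    proof (cases gs)
      case Nil
      then show ?thesis
        using assms parts by (simp add: cinner_simps cinner_ten)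
    next
      case (Cons g hs)
      with gs have g: "g \<in> L2_fun" "hs \<in> tensors" by auto
      have sym: "L2_inner g h = cnj (L2_inner h g)" if "h \<in> L2_fun" for h
        using that g by (simp add: L2_inner_eq_cinner cinner_commute[symmetric])
      have "L2_inner g f = L2_inner g (complexify (\<lambda>s. fst (f s)))
          + \<i> * L2_inner g (complexify (\<lambda>s. snd (f s)))"
        using L2_inner_decompose_left[OF assms(1) g(1)] parts assms(1) by (simp add: sym)
      then show ?thesis
        using assms parts g Cons by (simp add: cinner_simps cinner_ten_Cons algebra_simps
            del: in_lists_conv_set)
    qed
  qed
  then show "cinner u (ten (f # fs)) = cinner u (ten (complexify (\<lambda>s. fst (f s)) # fs)
    + \<i> *\<^sub>C ten (complexify (\<lambda>s. snd (f s)) # fs))"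
    by (simp add: algebra_simps)
qed

text \<open>Twice \<open>semicircular ten h\<close> applied to \<open>ten gs\<close> is the wanted
  tensor plus an annihilation term. That term is zero or a multiple of a tensor two factors shorter
  than the wanted one, hence strong induction on the length.\<close>

lemma ten_mem_orbit: "fs \<in> tensors \<Longrightarrow> ten fs \<in> orbit"
proof (induction "length fs" arbitrary: fs rule: less_induct)
  case less
  note sub = complex_vector.subspace_add[OF orbit_subspace]
    complex_vector.subspace_diff[OF orbit_subspace] complex_vector.subspace_scale[OF orbit_subspace]
  show ?case
  proof (cases fs)
    case Nil
    then show ?thesis by (simp add: vacuum_orbit)
  next
    case (Cons f gs)
    then have f: "f \<in> L2_fun" and gs: "gs \<in> tensors" using less.prems by auto
    have gs_orbit: "ten gs \<in> orbit" using less.hyps[of gs] gs Cons by simp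
    have real: "ten (complexify h # gs) \<in> orbit" if h: "h \<in> L2_fun" for h
    proof -
      note H = complexify_mem_L2_fun[OF h]
      have "la (complexify h) (ten gs) \<in> orbit"
      proof (cases gs)
        case Nil
        then show ?thesis
          using annihilation_vacuum[OF H] complex_vector.subspace_0[OF orbit_subspace] by simp
      next
        case (Cons k ks)
        then have "k \<in> L2_fun" "ks \<in> tensors" using gs by auto
        moreover have "ten ks \<in> orbit"
          using less.hyps[of ks] \<open>fs = f # gs\<close> Cons gs by simp
        ultimately show ?thesis
          using Cons H by (simp add: annihilation_ten_Cons sub)
      qed
      moreover have "2 *\<^sub>C u = 2 *\<^sub>R u" for u :: 'h
        using scaleC_of_real[of 2 u] by simp
      then have "ten (complexify h # gs) =
          2 *\<^sub>C semicircular ten h (ten gs) - la (complexify h) (ten gs)"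
        by (simp add: semicircular_def creation_ten H gs)
      ultimately show ?thesis
        using semicircular_orbit[OF h gs_orbit] by (simp add: sub)
    qed
    show ?thesis
      unfolding Cons ten_decompose[OF f gs]
      by (intro sub real fst_snd_mem_L2_fun f)
  qed
qed

lemma orbit_dense: "closure orbit = UNIV"
proof -
  have "complex_vector.span (ten ` tensors) \<subseteq> orbit"
    by (intro complex_vector.span_minimal orbit_subspace) (auto intro: ten_mem_orbit)
  then show ?thesis using total closure_mono by blast
qed

lemma standard_formI:
  assumes "modular_conjugation M (ten []) J"
  shows "standard_form M (ten []) J"
  by unfold_locales
    (simp_all only: M_bounded M_adjoint M_bicommutant orbit_dense[unfolded orbit_def] assms)

text \<open>On vectors orthogonal to the vacuum \<open>l(f)\<^sup>* r(f) = r(f) l(f)\<^sup>*\<close>, so \<open>l(f\<^sub>n) \<xi>\<close> and \<open>r(f\<^sub>n) \<xi>\<close>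
  become orthogonal as \<open>n \<rightarrow> \<infinity>\<close>, while the hypothesis makes their difference tend to zero.\<close>

lemma central_vector:
  fixes F :: "nat \<Rightarrow> real \<Rightarrow> 'k \<times> 'k"
  assumes F: "\<And>n. F n \<in> L2_fun"
    and orth: "\<And>m n. L2_inner (F m) (F n) = (if m = n then 1 else 0)"
    and central: "\<And>n. lc (F n) \<xi> + la (F n) \<xi> = rc (F n) \<xi> + ra (F n) \<xi>"
  shows "\<xi> = cinner (ten []) \<xi> *\<^sub>C ten []"
proof -
  have la0: "(\<lambda>n. la (F n) v) \<longlonglongrightarrow> 0" for v
    by (rule orthogonal_isometries_cadjoint_tendsto_0)
      (simp_all add: creation_bounded annihilation_creation F orth)
  have ra0: "(\<lambda>n. ra (F n) v) \<longlonglongrightarrow> 0" for v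
    by (rule orthogonal_isometries_cadjoint_tendsto_0)
      (simp_all add: right_creation_bounded right_annihilation_creation F orth)
  define \<zeta> where "\<zeta> = \<xi> - cinner (ten []) \<xi> *\<^sub>C ten []"
  have vac: "cinner (ten []) \<zeta> = 0"
    by (simp add: \<zeta>_def cinner_simps cinner_vacuum)
  \<comment> \<open>Left and right creation agree on the vacuum, so the vacuum component of
    \<open>\<xi>\<close> drops out of the difference.\<close>
  have d: "lc (F n) \<zeta> - rc (F n) \<zeta> = ra (F n) \<xi> - la (F n) \<xi>" for n
  proof -
    have "lc (F n) \<zeta> - rc (F n) \<zeta> = lc (F n) \<xi> - rc (F n) \<xi>"
      using bounded_clinearD(2,4)[OF creation_bounded[OF F[of n]]]
        bounded_clinearD(2,4)[OF right_creation_bounded[OF F[of n]]]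
      by (simp add: \<zeta>_def creation_ten right_creation_ten F)
    also have "\<dots> = ra (F n) \<xi> - la (F n) \<xi>"
      using central[of n] by (simp add: algebra_simps)
    finally show ?thesis .
  qed
  have norm_lc: "norm (lc (F n) \<zeta>) = norm \<zeta>" for n
  proof -
    have "cinner (lc (F n) \<zeta>) (lc (F n) \<zeta>) = cinner \<zeta> (la (F n) (lc (F n) \<zeta>))"
      by (simp add: cadjoint_cinner_right creation_bounded F)
    then have "(norm (lc (F n) \<zeta>))\<^sup>2 = (norm \<zeta>)\<^sup>2"
      by (simp add: annihilation_creation F orth cinner_self flip: of_real_power)
    then show ?thesis by simp
  qed
  \<comment> \<open>Since \<open>\<zeta>\<close> is orthogonal to the vacuum, \<open>la\<close>
    passes \<open>rc\<close> without correction. Each term on the right contains annihilation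
    operators and tends to 0, while the left side does not depend on \<open>n\<close>.\<close>
  have split: "cinner \<zeta> \<zeta> = cinner (lc (F n) \<zeta>) (ra (F n) \<xi> - la (F n) \<xi>)
      + cinner (ra (F n) \<zeta>) (la (F n) \<zeta>)" for n
  proof -
    have "cinner (lc (F n) \<zeta>) (rc (F n) \<zeta>) = cinner \<zeta> (la (F n) (rc (F n) \<zeta>))"
      by (simp add: cadjoint_cinner_right creation_bounded F)
    also have "\<dots> = cinner (ra (F n) \<zeta>) (la (F n) \<zeta>)"
      by (simp add: annihilation_right_creation F vac cadjoint_cinner_left right_creation_bounded)
    finally have "cinner (lc (F n) \<zeta>) (rc (F n) \<zeta>) = cinner (ra (F n) \<zeta>) (la (F n) \<zeta>)" .
    moreover have "cinner (lc (F n) \<zeta>) (lc (F n) \<zeta>) = cinner \<zeta> \<zeta>"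
      by (simp add: cinner_self norm_lc)
    ultimately show ?thesis
      unfolding d[symmetric] cinner_diff_right by simp
  qed
  have "(\<lambda>n. cinner (lc (F n) \<zeta>) (ra (F n) \<xi> - la (F n) \<xi>)) \<longlonglongrightarrow> 0"
  proof (rule Lim_null_comparison)
    show "\<forall>\<^sub>F n in sequentially. norm (cinner (lc (F n) \<zeta>) (ra (F n) \<xi> - la (F n) \<xi>))
        \<le> norm \<zeta> * norm (ra (F n) \<xi> - la (F n) \<xi>)"
      using norm_cinner_le[of "lc (F _) \<zeta>"] by (simp add: norm_lc)
    have "(\<lambda>n. norm \<zeta> * norm (ra (F n) \<xi> - la (F n) \<xi>)) \<longlonglongrightarrow> norm \<zeta> * norm (0 - 0 :: 'h)"
      by (intro tendsto_intros la0 ra0)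
    then show "(\<lambda>n. norm \<zeta> * norm (ra (F n) \<xi> - la (F n) \<xi>)) \<longlonglongrightarrow> 0" by simp
  qed
  moreover have "(\<lambda>n. cinner (ra (F n) \<zeta>) (la (F n) \<zeta>)) \<longlonglongrightarrow> cinner 0 (0 :: 'h)"
    by (intro tendsto_cinner la0 ra0)
  ultimately have "(\<lambda>n. cinner (lc (F n) \<zeta>) (ra (F n) \<xi> - la (F n) \<xi>)
      + cinner (ra (F n) \<zeta>) (la (F n) \<zeta>)) \<longlonglongrightarrow> 0 + cinner 0 (0 :: 'h)"
    by (rule tendsto_add)
  then have "(\<lambda>n :: nat. cinner \<zeta> \<zeta>) \<longlonglongrightarrow> 0"
    unfolding split[symmetric] by simp
  then have "cinner \<zeta> \<zeta> = 0"
    by (simp add: LIMSEQ_const_iff)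
  then show ?thesis by (simp add: \<zeta>_def)
qed

end

section \<open>The intertwiner spaces of the free flow\<close>

theorem proposition8p23:
  fixes ten :: "(real \<Rightarrow> 'k::{real_inner, banach, second_countable_topology} \<times> 'k) list \<Rightarrow>
      'h::complex_hilbert"
    and \<gamma> :: "real \<Rightarrow> ('h \<Rightarrow> 'h) \<Rightarrow> ('h \<Rightarrow> 'h)"
    and S :: "real \<Rightarrow> 'h \<Rightarrow> 'h"
    and J :: "'h \<Rightarrow> 'h"
  assumes "\<exists>x::'k. x \<noteq> 0"
    and "full_fock_space ten"
    and "free_flow ten \<gamma>"
    and "modular_conjugation (free_vN_algebra ten) (vacuum ten) J"
    and "canonical_unit (free_vN_algebra ten) (vacuum ten) \<gamma> S"
  shows "\<forall>t\<ge>0. intertwiners (free_vN_algebra ten) J \<gamma> t = {\<lambda>v. c *\<^sub>C S t v | c. True}"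
proof (intro allI impI)
  fix t :: real assume t: "0 \<le> t"
  interpret fock_space ten by unfold_locales fact
  interpret standard_form M "ten []" J using assms(4) by (rule standard_formI)
  have \<gamma>_endo: "normal_unital_star_endomorphism M (\<gamma> t)"
    using assms(3) t by (auto simp: free_flow_def endomorphism_semigroup_def)
  have \<gamma>_mem: "\<gamma> t x \<in> M" and \<gamma>_adj: "\<gamma> t (cadjoint x) = cadjoint (\<gamma> t x)"
    and \<gamma>_comp: "y \<in> M \<Longrightarrow> \<gamma> t (x \<circ> y) = \<gamma> t x \<circ> \<gamma> t y" if "x \<in> M" for x y
    using \<gamma>_endo that by (auto simp: normal_unital_star_endomorphism_def)
  have \<gamma>_s: "\<gamma> t (semicircular ten f) = semicircular ten (shift t f)" if "f \<in> L2_fun" for f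
    using assms(3) t that by (auto simp: free_flow_def)
  have S: "bounded_clinear (S t)" and S_orbit: "x \<in> M \<Longrightarrow> S t (x (ten [])) = \<gamma> t x (ten [])" for x
    using assms(5) t by (auto simp: canonical_unit_def)
  \<comment> \<open>Both operators send the vacuum to half of \<open>ten [complexify f]\<close>,
    which is what \<open>J_conj_eqI\<close> asks for.\<close>
  have J_s: "J \<circ> semicircular ten f \<circ> J = right_semicircular f" if "f \<in> L2_fun" for f
    using that by (intro J_conj_eqI semicircular_mem cadjoint_semicircular
        right_semicircular_mem_commutant) (simp_all add: semicircular_vacuum)
  show "intertwiners M J \<gamma> t = {\<lambda>v. c *\<^sub>C S t v | c. True}"
  proof (intro equalityI subsetI)
    fix T assume "T \<in> intertwiners M J \<gamma> t"
    then have T: "bounded_clinear T"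
      and left: "\<And>m v. m \<in> M \<Longrightarrow> \<gamma> t m (T v) = T (m v)"
      and right: "\<And>m' v. m' \<in> commutant M \<Longrightarrow> complementary J \<gamma> t m' (T v) = T (m' v)"
      by (auto simp: intertwiners_def fun_eq_iff)
    define \<xi> where "\<xi> = T (ten [])"
    \<comment> \<open>Both sides equal \<open>T\<close> at the common value of
      \<open>semicircular ten f\<close> and \<open>right_semicircular f\<close> on the vacuum.
      Membership of \<open>shift t f\<close> is assumed, to be checked for bumps alone.\<close>
    have central: "semicircular ten (shift t f) \<xi> = right_semicircular (shift t f) \<xi>"
      if f: "f \<in> L2_fun" and sf: "shift t f \<in> L2_fun" for f
    proof -
      have "J \<circ> right_semicircular f \<circ> J = semicircular ten f"
        by (simp add: J_s[OF f, symmetric] fun_eq_iff)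
      then have "complementary J \<gamma> t (right_semicircular f) = right_semicircular (shift t f)"
        by (simp add: complementary_def \<gamma>_s f J_s[OF sf])
      then show ?thesis
        using left[OF semicircular_mem[OF f], of "ten []"]
          right[OF right_semicircular_mem_commutant[OF f], of "ten []"]
        by (simp add: \<xi>_def \<gamma>_s f semicircular_vacuum)
    qed
    obtain y :: 'k where "y \<noteq> 0" using assms(1) by blast
    \<comment> \<open>One unit vector is enough for every rank, including one: the infinite
      orthonormal sequence comes from the time variable.\<close>
    define x where "x = sgn y"
    have x: "norm x = 1" using \<open>y \<noteq> 0\<close> by (simp add: x_def norm_sgn)
    have \<xi>: "\<xi> = cinner (ten []) \<xi> *\<^sub>C ten []"
    proof (rule central_vector)
      fix m n
      show "complexify (bump (t + real n) x) \<in> L2_fun"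
        using t by (intro complexify_mem_L2_fun bump_mem_L2_fun) simp
      show "L2_inner (complexify (bump (t + real m) x)) (complexify (bump (t + real n) x)) =
          (if m = n then 1 else 0)"
        using t x by (rule L2_inner_bump)
      \<comment> \<open>This bump is \<open>shift t (bump (real n) x)\<close>, so
        \<open>central\<close> applies.\<close>
      have "semicircular ten (bump (t + real n) x) \<xi> = right_semicircular (bump (t + real n) x) \<xi>"
        using central[of "bump (real n) x"] t by (simp add: shift_bump bump_mem_L2_fun)
      then show "lc (complexify (bump (t + real n) x)) \<xi> + la (complexify (bump (t + real n) x)) \<xi> =
          rc (complexify (bump (t + real n) x)) \<xi> + ra (complexify (bump (t + real n) x)) \<xi>"
        by (simp add: semicircular_def right_semicircular_def)
    qed
    define c where "c = cinner (ten []) \<xi>"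
    have "T = (\<lambda>v. c *\<^sub>C S t v)"
    proof (rule eq_on_vacuum)
      fix m assume m: "m \<in> M"
      have "T (m (ten [])) = \<gamma> t m (c *\<^sub>C ten [])"
        using left[OF m, of "ten []"] \<xi> by (simp add: \<xi>_def[symmetric] c_def)
      then show "T (m (ten [])) = c *\<^sub>C S t (m (ten []))"
        by (simp add: S_orbit m bounded_clinearD(2)[OF bounded[OF \<gamma>_mem[OF m]]])
    qed (intro T bounded_clinear_scaleC S)+
    then show "T \<in> {\<lambda>v. c *\<^sub>C S t v | c. True}" by blast
  next
    fix T assume "T \<in> {\<lambda>v. c *\<^sub>C S t v | c. True}"
    then obtain c where T: "T = (\<lambda>v. c *\<^sub>C S t v)" by blast
    have left: "\<gamma> t m (S t v) = S t (m v)" if m: "m \<in> M" for m v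
    proof -
      have "\<gamma> t m \<circ> S t = S t \<circ> m"
      proof (rule eq_on_vacuum)
        fix x assume x: "x \<in> M"
        show "(\<gamma> t m \<circ> S t) (x (ten [])) = (S t \<circ> m) (x (ten []))"
          using S_orbit[OF comp_mem[OF m x]] by (simp add: S_orbit x \<gamma>_comp m)
      qed (intro bounded_clinear_comp S bounded \<gamma>_mem m)+
      from fun_cong[OF this, of v] show ?thesis by simp
    qed
    \<comment> \<open>On \<open>x \<Omega>\<close> this reduces to \<open>\<gamma> t\<close>
      preserving adjoints.\<close>
    have J_S: "J (S t v) = S t (J v)" for v
    proof -
      have "J \<circ> S t \<circ> J = S t"
      proof (rule eq_on_vacuum)
        fix x assume x: "x \<in> M"
        show "(J \<circ> S t \<circ> J) (x (ten [])) = S t (x (ten []))"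
          using x by (simp add: J_apply S_orbit adjoint_mem \<gamma>_adj \<gamma>_mem cadjoint_cadjoint bounded)
      qed (intro bounded_clinear_J_conj S)+
      from fun_cong[OF this, of "J v"] show ?thesis by simp
    qed
    \<comment> \<open>Conjugation by \<open>J\<close> carries \<open>m'\<close> into
      \<open>M\<close>, where \<open>left\<close> applies; \<open>J_S\<close> then moves
      \<open>S t\<close> past \<open>J\<close>.\<close>
    have right: "complementary J \<gamma> t m' (S t v) = S t (m' v)" if "m' \<in> commutant M" for m' v
      using left[OF J_conj_commutant[OF that]] by (simp add: complementary_def J_S)
    \<comment> \<open>The scalar crosses two conjugate-linear maps \<open>J\<close>, so it comes out
      unconjugated.\<close>
    have bl: "complementary J \<gamma> t m' (c *\<^sub>C v) = c *\<^sub>C complementary J \<gamma> t m' v"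
      if "m' \<in> commutant M" for m' v
      using bounded_clinearD(2)[OF bounded_clinear_J_conj[OF bounded[OF \<gamma>_mem[OF
              J_conj_commutant[OF that]]]]]
      by (simp add: complementary_def)
    have "bounded_clinear T"
      unfolding T by (intro bounded_clinear_scaleC S)
    moreover have "\<gamma> t m (T v) = T (m v)" if "m \<in> M" for m v
      unfolding T bounded_clinearD(2)[OF bounded[OF \<gamma>_mem[OF that]]] left[OF that] ..
    moreover have "complementary J \<gamma> t m' (T v) = T (m' v)" if "m' \<in> commutant M" for m' v
      unfolding T bl[OF that] right[OF that] ..
    ultimately show "T \<in> intertwiners M J \<gamma> t"
      by (auto simp: intertwiners_def)
  qed
qed

end
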